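(* Let $\theta\in[0,1]$, let $(p_x,q_x)_{x\in\mathbb Z}$ be uniformly bounded nonnegative jump rates, and let $(\eta_t)_{t\ge0}$ be the mixed coalescing/annihilating nearest-neighbour particle system on $\mathbb Z$ described in the context. For any deterministic initial condition $\eta\in\{0,1\}^{\mathbb Z}$ and at any fixed time $t\ge0$, under $\mathbf P_\eta$ the configuration $\eta_t$ is a Pfaffian point process on $\mathbb Z$ whose kernel $\mathbf K:\mathbb Z^2\to\mathbb R^{2\times2}$ is given, for $y<z$, by \[ \mathbf K(y,z)=\frac{1}{1+\theta}\begin{pmatrix} K_t(y,z) & -D^+_2K_t(y,z)\\ -D^+_1K_t(y,z) & D^+_1D^+_2K_t(y,z)\end{pmatrix}, \] by $\mathbf K_{12}(y,y)=\frac{-1}{1+\theta}D^+_2K_t(y,y)$, and with all other entries determined by the symmetry relations $\mathbf K_{ij}(y,z)=-\mathbf K_{ji}(z,y)$, $i,j\in\{1,2\}$, $y,z\in\mathbb Z$. Here $K_t(y,z)=\mathbf E_\eta[\sigma_{y,z}(\eta_t)]$ for $y\le z$.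
   Context: The process: between interactions, particles perform independent nearest-neighbour random walks, a particle jumping $x\to x-1$ at rate $q_x$ and $x-1\to x$ at rate $p_x$; when a particle jumps onto an occupied site, with probability $\theta$ both particles disappear (annihilation) and with probability $1-\theta$ one particle remains (coalescence). Formally $\eta_t\in\{0,1\}^{\mathbb Z}$ ($\eta_t(x)=1$ means a particle at $x$) is the Markov process with generator, for $F$ depending on finitely many coordinates, $\mathcal L F(\eta)=\sum_{x}q_x\big(\theta F(\eta^a_{x,x-1})+(1-\theta)F(\eta^c_{x,x-1})-F(\eta)\big)+\sum_x p_x\big(\theta F(\eta^a_{x-1,x})+(1-\theta)F(\eta^c_{x-1,x})-F(\eta)\big)$, where for $x\neq y$ the configurations $\eta^a_{x,y},\eta^c_{x,y}$ agree with $\eta$ off $\{x,y\}$, vanish at $x$, and $\eta^a_{x,y}(y)=(\eta(x)+\eta(y))\bmod 2$, $\eta^c_{x,y}(y)=\min\{1,\eta(x)+\eta(y)\}$. $\mathbf P_\eta,\mathbf E_\eta$ denote law and expectation started from $\eta$. Notation: for $y<z$, $\eta[y,z)=\sum_{y\le x<z}\eta(x)$, and $\eta[y,y)=0$; $\sigma_{y,z}(\eta)=(-\theta)^{\eta[y,z)}$ with the convention $0^0=1$. $D^+f(x)=f(x+1)-f(x)$, and $D^+_i$ means $D^+$ applied in the $i$th variable. Pfaffian: for an antisymmetric $2n\times2n$ matrix $A$, $\mathrm{Pf}(A)=\frac{1}{2^nn!}\sum_{\pi\in S_{2n}}\mathrm{sgn}(\pi)\prod_{i=1}^n a_{\pi(2i-1)\pi(2i)}$.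 A random $\eta\in\{0,1\}^{\mathbb Z}$ is a Pfaffian point process with kernel $\mathbf K:\mathbb Z^2\to\mathbb R^{2\times2}$ (satisfying $\mathbf K_{ij}(y,z)=-\mathbf K_{ji}(z,y)$) if for every $n\ge1$ and distinct $x_1,\dots,x_n$, $\mathbf E[\eta(x_1)\cdots\eta(x_n)]=\mathrm{Pf}(\mathbf K(x_i,x_j))_{i,j\le n}$, where the $2n\times2n$ antisymmetric matrix is built from the $2\times2$ blocks $\mathbf K(x_i,x_j)$. *)

theory Defs
  imports "HOL-Probability.Probability" "HOL-Combinatorics.Permutations"
begin

text \<open>Configurations: \<open>\<eta> :: int \<Rightarrow> bool\<close>, \<open>\<eta> x = True\<close> means a particle at x.
  The state space {0,1}^Z carries the product sigma-algebra.\<close>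

type_synonym config = "int \<Rightarrow> bool"

definition config_space :: "config measure" where
  "config_space = Pi\<^sub>M UNIV (\<lambda>_. count_space UNIV)"

definition ann_upd :: "int \<Rightarrow> int \<Rightarrow> config \<Rightarrow> config" where
  "ann_upd x y \<eta> = \<eta>(x := False, y := (\<eta> x \<noteq> \<eta> y))"

definition coal_upd :: "int \<Rightarrow> int \<Rightarrow> config \<Rightarrow> config" where
  "coal_upd x y \<eta> = \<eta>(x := False, y := (\<eta> x \<or> \<eta> y))"

definition cylinder :: "(config \<Rightarrow> real) \<Rightarrow> bool" where
  "cylinder F \<longleftrightarrow> (\<exists>S. finite S \<and> (\<forall>\<eta> \<eta>'. (\<forall>x\<in>S. \<eta> x = \<eta>' x) \<longrightarrow> F \<eta> = F \<eta>'))"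

text \<open>The generator (applied to cylinder functions, where the sums have finitely many nonzero terms).\<close>
definition generator ::
  "real \<Rightarrow> (int \<Rightarrow> real) \<Rightarrow> (int \<Rightarrow> real) \<Rightarrow> (config \<Rightarrow> real) \<Rightarrow> config \<Rightarrow> real" where
  "generator \<theta> p q F \<eta> =
     (\<Sum>\<^sub>\<infinity>x. q x * (\<theta> * F (ann_upd x (x - 1) \<eta>) + (1 - \<theta>) * F (coal_upd x (x - 1) \<eta>) - F \<eta>))
   + (\<Sum>\<^sub>\<infinity>x. p x * (\<theta> * F (ann_upd (x - 1) x \<eta>) + (1 - \<theta>) * F (coal_upd (x - 1) x \<eta>) - F \<eta>))"

text \<open>\<open>\<mu> t\<close> is the law of eta_t under P_eta: the (unique) solution of the Kolmogorov
  forward equation d/dt E[F(eta_t)] = E[(L F)(eta_t)] for all cylinder functions F,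
  started from the point mass at eta.\<close>
definition is_process_law ::
  "real \<Rightarrow> (int \<Rightarrow> real) \<Rightarrow> (int \<Rightarrow> real) \<Rightarrow> config \<Rightarrow> (real \<Rightarrow> config measure) \<Rightarrow> bool" where
  "is_process_law \<theta> p q \<eta> \<mu> \<longleftrightarrow>
     (\<forall>t\<ge>0. prob_space (\<mu> t) \<and> sets (\<mu> t) = sets config_space) \<and>
     \<mu> 0 = return config_space \<eta> \<and>
     (\<forall>F. cylinder F \<longrightarrow> (\<forall>t\<ge>0.
        ((\<lambda>s. \<integral>\<omega>. F \<omega> \<partial>(\<mu> s)) has_real_derivative (\<integral>\<omega>. generator \<theta> p q F \<omega> \<partial>(\<mu> t)))
          (at t within {0..})))"

definition count_in :: "config \<Rightarrow> int \<Rightarrow> int \<Rightarrow> nat" where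
  "count_in \<eta> y z = card {x. y \<le> x \<and> x < z \<and> \<eta> x}"

text \<open>sigma_{y,z}(eta) = (-theta)^{eta[y,z)}, with 0^0 = 1 (as in Isabelle).\<close>
definition sigma_fn :: "real \<Rightarrow> int \<Rightarrow> int \<Rightarrow> config \<Rightarrow> real" where
  "sigma_fn \<theta> y z \<eta> = (- \<theta>) ^ count_in \<eta> y z"

definition pfaffian :: "nat \<Rightarrow> (nat \<Rightarrow> nat \<Rightarrow> real) \<Rightarrow> real" where
  "pfaffian n A = (1 / (2 ^ n * fact n)) *
     (\<Sum>\<pi> | \<pi> permutes {0..<2*n}. of_int (sign \<pi>) * (\<Prod>i<n. A (\<pi> (2*i)) (\<pi> (2*i+1))))"

text \<open>A 2x2-matrix-valued kernel is represented as K y z i j with i,j in {0,1}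
  (standing for the indices 1,2 of the paper).  M is a Pfaffian point process with kernel K.\<close>
definition pfaffian_pp :: "config measure \<Rightarrow> (int \<Rightarrow> int \<Rightarrow> nat \<Rightarrow> nat \<Rightarrow> real) \<Rightarrow> bool" where
  "pfaffian_pp M K \<longleftrightarrow>
     (\<forall>y z i j. i < 2 \<longrightarrow> j < 2 \<longrightarrow> K y z i j = - K z y j i) \<and>
     (\<forall>xs. xs \<noteq> [] \<longrightarrow> distinct xs \<longrightarrow>
        (\<integral>\<omega>. (\<Prod>x\<leftarrow>xs. of_bool (\<omega> x)) \<partial>M) =
        pfaffian (length xs) (\<lambda>a b. K (xs ! (a div 2)) (xs ! (b div 2)) (a mod 2) (b mod 2)))"

text \<open>The kernel of the theorem, built from Kt (Kt y z = E[sigma_{y,z}(eta_t)] for y \<le> z).\<close>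
definition kernel_block :: "real \<Rightarrow> (int \<Rightarrow> int \<Rightarrow> real) \<Rightarrow> int \<Rightarrow> int \<Rightarrow> nat \<Rightarrow> nat \<Rightarrow> real" where
  "kernel_block \<theta> Kt y z i j =
     (1 / (1 + \<theta>)) *
     (if i = 0 \<and> j = 0 then Kt y z
      else if i = 0 \<and> j = 1 then - (Kt y (z + 1) - Kt y z)
      else if i = 1 \<and> j = 0 then - (Kt (y + 1) z - Kt y z)
      else Kt (y + 1) (z + 1) - Kt (y + 1) z - Kt y (z + 1) + Kt y z)"

definition pf_kernel :: "real \<Rightarrow> (int \<Rightarrow> int \<Rightarrow> real) \<Rightarrow> int \<Rightarrow> int \<Rightarrow> nat \<Rightarrow> nat \<Rightarrow> real" where
  "pf_kernel \<theta> Kt y z i j =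
     (if y < z then kernel_block \<theta> Kt y z i j
      else if z < y then - kernel_block \<theta> Kt z y j i
      else if i = 0 \<and> j = 1 then (-1 / (1 + \<theta>)) * (Kt y (y + 1) - Kt y y)
      else if i = 1 \<and> j = 0 then (1 / (1 + \<theta>)) * (Kt y (y + 1) - Kt y y)
      else 0)"

end

theory Submission
  imports Defs
begin

text \<open>
  For a finite set \<open>I\<close> of sites let \<open>spin \<theta> I \<eta>\<close> be the product of \<open>(-\<theta>)\<^bsup>\<eta>(x)\<^esup>\<close> over \<open>x \<in> I\<close>.
  Averaged over annihilation and coalescence, a jump from \<open>a\<close> to \<open>b\<close> replaces \<open>I\<close> by the set in which
  \<open>a\<close> has the same membership as \<open>b\<close>. Hence, for a union of intervals with distinct end points, the
  generator moves each end point as an independent random walk, and the expectations of these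
  products satisfy a closed linear system in the cell \<open>y\<^sub>0 < \<dots> < y\<^bsub>2n-1\<^esub>\<close>. When two neighbouring end points
  meet, both disappear. The Pfaffian of the two-point expectations satisfies the same system, the
  same boundary condition (two equal rows), and the same initial condition (the initial matrix is
  multiplicative). Since the rates are bounded, bounded solutions are unique, by Picard iteration.
  Finally \<open>(1 + \<theta>) \<eta>(x) = 1 - spin \<theta> {x} \<eta>\<close>, and row differences turn the Pfaffian for the
  interval products into the Pfaffian for the correlation functions.
\<close>

section \<open>Pfaffians as sums over permutations\<close>

definition pf_term :: "nat \<Rightarrow> (nat \<Rightarrow> nat \<Rightarrow> real) \<Rightarrow> (nat \<Rightarrow> nat) \<Rightarrow> real" where
  "pf_term n A \<pi> = (\<Prod>i<n. A (\<pi> (2*i)) (\<pi> (2*i+1)))"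

definition pf_sum :: "nat \<Rightarrow> (nat \<Rightarrow> nat \<Rightarrow> real) \<Rightarrow> real" where
  "pf_sum n A = (\<Sum>\<pi> | \<pi> permutes {0..<2*n}. of_int (sign \<pi>) * pf_term n A \<pi>)"

lemma pfaffian_eq_pf_sum: "pfaffian n A = pf_sum n A / (2 ^ n * fact n)"
  by (simp add: pfaffian_def pf_sum_def pf_term_def)

lemma permutes_even_odd:
  fixes n :: nat
  assumes "\<pi> permutes {0..<2*n}" "i < n"
  shows "\<pi> (2*i) < 2*n" "\<pi> (2*i+1) < 2*n" "\<pi> (2*i) \<noteq> \<pi> (2*i+1)"
proof -
  show "\<pi> (2*i) < 2*n" "\<pi> (2*i+1) < 2*n"
    using permutes_in_image[OF assms(1), of "2*i"] permutes_in_image[OF assms(1), of "2*i+1"] assms(2)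
    by auto
  show "\<pi> (2*i) \<noteq> \<pi> (2*i+1)"
    using permutes_inj[OF assms(1)] by (simp add: inj_eq)
qed

text \<open>A permutation never pairs an index with itself, so diagonal entries do not enter the
  Pfaffian.\<close>

lemma pf_term_cong:
  assumes "\<pi> permutes {0..<2*n}"
    and "\<And>a b. a < 2*n \<Longrightarrow> b < 2*n \<Longrightarrow> a \<noteq> b \<Longrightarrow> A a b = B a b"
  shows "pf_term n A \<pi> = pf_term n B \<pi>"
  unfolding pf_term_def
  using permutes_even_odd[OF assms(1)] by (intro prod.cong refl assms(2)) auto

lemma pfaffian_cong:
  assumes "\<And>a b. a < 2*n \<Longrightarrow> b < 2*n \<Longrightarrow> a \<noteq> b \<Longrightarrow> A a b = B a b"
  shows "pfaffian n A = pfaffian n B"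
  unfolding pfaffian_eq_pf_sum pf_sum_def
  by (intro arg_cong2[where f="(/)"] arg_cong2[where f="(*)"] sum.cong refl pf_term_cong assms) auto

lemma pfaffian_0 [simp]: "pfaffian 0 A = 1"
  by (simp add: pfaffian_def)

lemma pfaffian_scale: "pfaffian n (\<lambda>a b. c * A a b) = c ^ n * pfaffian n A"
  unfolding pfaffian_eq_pf_sum pf_sum_def pf_term_def
  by (simp add: prod.distrib sum_distrib_left mult_ac)

lemma pfaffian_permute:
  assumes \<rho>: "\<rho> permutes {0..<2*n}"
  shows "pfaffian n (\<lambda>a b. A (\<rho> a) (\<rho> b)) = of_int (sign \<rho>) * pfaffian n A"
proof -
  let ?S = "{0..<2*n}"
  have perm: "permutation \<pi>" if "\<pi> permutes ?S" for \<pi> :: "nat \<Rightarrow> nat"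
    using that permutation_permutes by blast
  have "pf_sum n A = (\<Sum>\<pi> | \<pi> permutes ?S. of_int (sign (\<rho> \<circ> \<pi>)) * pf_term n A (\<rho> \<circ> \<pi>))"
    unfolding pf_sum_def by (rule setum_permutations_compose_left[OF \<rho>])
  also have "\<dots> = (\<Sum>\<pi> | \<pi> permutes ?S.
      of_int (sign \<rho>) * (of_int (sign \<pi>) * pf_term n (\<lambda>a b. A (\<rho> a) (\<rho> b)) \<pi>))"
    by (intro sum.cong refl)
      (auto simp: sign_compose[OF perm[OF \<rho>] perm] pf_term_def)
  also have "\<dots> = of_int (sign \<rho>) * pf_sum n (\<lambda>a b. A (\<rho> a) (\<rho> b))"
    by (simp add: pf_sum_def sum_distrib_left)
  finally have "of_int (sign \<rho>) * pf_sum n A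
      = (of_int (sign \<rho> * sign \<rho>) :: real) * pf_sum n (\<lambda>a b. A (\<rho> a) (\<rho> b))"
    by (simp only: of_int_mult mult.assoc)
  then show ?thesis
    by (simp only: pfaffian_eq_pf_sum sign_idempotent of_int_1 mult_1_left times_divide_eq_right)
qed

section \<open>Linearity and differentiation of the Pfaffian, one row at a time\<close>

lemma sum_even_odd:
  "(\<Sum>m<2*n. f m) = (\<Sum>i<n. f (2*i) + f (2*i+1))" for f :: "nat \<Rightarrow> 'a::comm_monoid_add"
  by (induction n) (auto simp: algebra_simps)

lemma prod_even_odd:
  "(\<Prod>m<2*n. f m) = (\<Prod>i<n. f (2*i) * f (2*i+1))" for f :: "nat \<Rightarrow> 'a::comm_monoid_mult"
  by (induction n) (simp_all add: mult.assoc)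

text \<open>A permutation visits the index \<open>k\<close> once, in the pair at position
  \<open>i\<close>; so a change of row and column \<open>k\<close> can affect only that
  factor.\<close>

lemma pf_term_change_row:
  assumes \<pi>: "\<pi> permutes {0..<2*n}" and i: "i < n" and k: "k = \<pi> (2*i) \<or> k = \<pi> (2*i+1)"
    and off: "\<And>a b. a < 2*n \<Longrightarrow> b < 2*n \<Longrightarrow> a \<noteq> k \<Longrightarrow> b \<noteq> k \<Longrightarrow> B a b = A a b"
  shows "pf_term n B \<pi> = B (\<pi> (2*i)) (\<pi> (2*i+1)) * (\<Prod>j\<in>{..<n}-{i}. A (\<pi> (2*j)) (\<pi> (2*j+1)))"
proof -
  have "pf_term n B \<pi> = B (\<pi> (2*i)) (\<pi> (2*i+1)) * (\<Prod>j\<in>{..<n}-{i}. B (\<pi> (2*j)) (\<pi> (2*j+1)))"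
    unfolding pf_term_def using i by (intro prod.remove) auto
  also have "(\<Prod>j\<in>{..<n}-{i}. B (\<pi> (2*j)) (\<pi> (2*j+1))) = (\<Prod>j\<in>{..<n}-{i}. A (\<pi> (2*j)) (\<pi> (2*j+1)))"
  proof (intro prod.cong refl off)
    fix j assume j: "j \<in> {..<n}-{i}"
    have ne: "\<pi> x \<noteq> \<pi> y" if "x \<noteq> y" for x y
      using permutes_inj[OF \<pi>] that by (simp add: inj_eq)
    have "2*j \<noteq> 2*i" "2*j \<noteq> 2*i+1" "2*j+1 \<noteq> 2*i" "2*j+1 \<noteq> 2*i+1" using j by (auto; presburger)+
    from this[THEN ne] show "\<pi> (2*j) \<noteq> k" "\<pi> (2*j+1) \<noteq> k" using k by auto
    show "\<pi> (2*j) < 2*n" "\<pi> (2*j+1) < 2*n" using permutes_even_odd[OF \<pi>] j by auto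
  qed
  finally show ?thesis .
qed

lemma permutes_pair_index:
  fixes n :: nat
  assumes \<pi>: "\<pi> permutes {0..<2*n}" and k: "k < 2*n"
  obtains i where "i < n" "k = \<pi> (2*i) \<or> k = \<pi> (2*i+1)"
proof -
  obtain m where m: "m < 2*n" "k = \<pi> m"
    using permutes_image[OF \<pi>] k by (metis atLeast0LessThan imageE lessThan_iff)
  have "m div 2 < n" "m = 2 * (m div 2) \<or> m = 2 * (m div 2) + 1" using m by auto
  then show ?thesis using that[of "m div 2"] m(2) by metis
qed

text \<open>Each term has exactly one factor containing the index \<open>k\<close>, so the Pfaffian
  is linear in row and column \<open>k\<close> taken together.\<close>

lemma pfaffian_row_diff:
  assumes k: "k < 2*n"
    and B: "\<And>a b. a < 2*n \<Longrightarrow> b < 2*n \<Longrightarrow> a \<noteq> k \<Longrightarrow> b \<noteq> k \<Longrightarrow> B a b = A a b"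
    and C: "\<And>a b. a < 2*n \<Longrightarrow> b < 2*n \<Longrightarrow> a \<noteq> k \<Longrightarrow> b \<noteq> k \<Longrightarrow> C a b = A a b"
    and diff: "\<And>a b. a < 2*n \<Longrightarrow> b < 2*n \<Longrightarrow> a \<noteq> b \<Longrightarrow> a = k \<or> b = k \<Longrightarrow> A a b = B a b - C a b"
  shows "pfaffian n A = pfaffian n B - pfaffian n C"
proof -
  have "pf_term n A \<pi> = pf_term n B \<pi> - pf_term n C \<pi>" if \<pi>: "\<pi> permutes {0..<2*n}" for \<pi>
  proof -
    obtain i where i: "i < n" "k = \<pi> (2*i) \<or> k = \<pi> (2*i+1)"
      using permutes_pair_index[OF \<pi> k] .
    have "A (\<pi> (2*i)) (\<pi> (2*i+1)) = B (\<pi> (2*i)) (\<pi> (2*i+1)) - C (\<pi> (2*i)) (\<pi> (2*i+1))"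
      using permutes_even_odd[OF \<pi> i(1)] i(2) by (intro diff) auto
    then show ?thesis
      using pf_term_change_row[OF \<pi> i, of B A] pf_term_change_row[OF \<pi> i, of C A]
        pf_term_change_row[OF \<pi> i, of A A] B C by (simp add: left_diff_distrib)
  qed
  then have "pf_sum n A = pf_sum n B - pf_sum n C"
    unfolding pf_sum_def sum_subtractf[symmetric]
    by (intro sum.cong refl) (simp add: right_diff_distrib)
  then show ?thesis by (simp add: pfaffian_eq_pf_sum diff_divide_distrib)
qed

text \<open>The rows are regrouped by the pair that contains them. The right-hand side then has the
  shape of the Leibniz rule for the product \<open>pf_term n A \<pi>\<close>.\<close>

lemma pf_term_row_sum:
  assumes \<pi>: "\<pi> permutes {0..<2*n}"
    and B: "\<And>k a b. k < 2*n \<Longrightarrow> a < 2*n \<Longrightarrow> b < 2*n \<Longrightarrow> a \<noteq> k \<Longrightarrow> b \<noteq> k \<Longrightarrow> B k a b = A a b"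
  shows "(\<Sum>k<2*n. c k * (pf_term n (B k) \<pi> - pf_term n A \<pi>)) =
    (\<Sum>i<n. (\<Sum>k\<in>{\<pi> (2*i), \<pi> (2*i+1)}. c k * (B k (\<pi> (2*i)) (\<pi> (2*i+1)) - A (\<pi> (2*i)) (\<pi> (2*i+1))))
       * (\<Prod>j\<in>{..<n}-{i}. A (\<pi> (2*j)) (\<pi> (2*j+1))))"
proof -
  define g where "g k = c k * (pf_term n (B k) \<pi> - pf_term n A \<pi>)" for k
  have "(\<Sum>k<2*n. g k) = (\<Sum>m<2*n. g (\<pi> m))"
    using sum.permute[OF \<pi>, of g] by (simp add: o_def atLeast0LessThan)
  also have "\<dots> = (\<Sum>i<n. g (\<pi> (2*i)) + g (\<pi> (2*i+1)))" by (rule sum_even_odd)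
  also have "\<dots> = (\<Sum>i<n. (\<Sum>k\<in>{\<pi> (2*i), \<pi> (2*i+1)}. c k * (B k (\<pi> (2*i)) (\<pi> (2*i+1)) - A (\<pi> (2*i)) (\<pi> (2*i+1))))
       * (\<Prod>j\<in>{..<n}-{i}. A (\<pi> (2*j)) (\<pi> (2*j+1))))"
  proof (intro sum.cong refl)
    fix i assume "i \<in> {..<n}"
    then have i: "i < n" by simp
    note bd = permutes_even_odd[OF \<pi> i]
    have "g k = c k * (B k (\<pi> (2*i)) (\<pi> (2*i+1)) - A (\<pi> (2*i)) (\<pi> (2*i+1)))
       * (\<Prod>j\<in>{..<n}-{i}. A (\<pi> (2*j)) (\<pi> (2*j+1)))" if k: "k = \<pi> (2*i) \<or> k = \<pi> (2*i+1)" for k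
    proof -
      have "k < 2*n" using k bd by auto
      then show ?thesis
        using pf_term_change_row[OF \<pi> i k, of "B k" A] pf_term_change_row[OF \<pi> i k, of A A] B[of k]
        unfolding g_def by (simp add: left_diff_distrib right_diff_distrib)
    qed
    then show "g (\<pi> (2*i)) + g (\<pi> (2*i+1)) = (\<Sum>k\<in>{\<pi> (2*i), \<pi> (2*i+1)}. c k * (B k (\<pi> (2*i)) (\<pi> (2*i+1)) - A (\<pi> (2*i)) (\<pi> (2*i+1))))
       * (\<Prod>j\<in>{..<n}-{i}. A (\<pi> (2*j)) (\<pi> (2*j+1)))"
      using bd(3) by (simp add: distrib_right)
  qed
  finally show ?thesis by (simp add: g_def)
qed

lemma has_real_derivative_prod_within:
  fixes f :: "'a \<Rightarrow> real \<Rightarrow> real"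
  assumes "\<And>i. i \<in> I \<Longrightarrow> (f i has_real_derivative f' i) (at t within S)"
  shows "((\<lambda>s. \<Prod>i\<in>I. f i s) has_real_derivative (\<Sum>i\<in>I. f' i * (\<Prod>j\<in>I-{i}. f j t))) (at t within S)"
proof -
  have "((\<lambda>s. \<Prod>i\<in>I. f i s) has_derivative (\<lambda>y. \<Sum>i\<in>I. f' i * y * (\<Prod>j\<in>I-{i}. f j t))) (at t within S)"
    using assms by (intro has_derivative_prod) (auto simp: has_field_derivative_def)
  then show ?thesis
    unfolding has_field_derivative_def
    by (rule has_derivative_eq_rhs) (auto simp: sum_distrib_left mult_ac)
qed

text \<open>In \<open>P k\<close> and \<open>N k\<close> the index \<open>k\<close> has moved by one
  step, in the two directions. If each entry evolves by moves of its own two indices, the Leibniz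
  rule puts these moves into one factor at a time, and \<open>pf_term_row_sum\<close> reassembles
  them as moves of whole rows.\<close>

lemma pfaffian_has_derivative:
  fixes A :: "real \<Rightarrow> nat \<Rightarrow> nat \<Rightarrow> real" and P N :: "nat \<Rightarrow> nat \<Rightarrow> nat \<Rightarrow> real"
  assumes der: "\<And>a b. a < 2*n \<Longrightarrow> b < 2*n \<Longrightarrow> a \<noteq> b \<Longrightarrow>
      ((\<lambda>s. A s a b) has_real_derivative
        (\<Sum>k\<in>{a,b}. q k * (P k a b - A t a b) + p k * (N k a b - A t a b))) (at t within S)"
    and P: "\<And>k a b. k < 2*n \<Longrightarrow> a < 2*n \<Longrightarrow> b < 2*n \<Longrightarrow> a \<noteq> k \<Longrightarrow> b \<noteq> k \<Longrightarrow> P k a b = A t a b"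
    and N: "\<And>k a b. k < 2*n \<Longrightarrow> a < 2*n \<Longrightarrow> b < 2*n \<Longrightarrow> a \<noteq> k \<Longrightarrow> b \<noteq> k \<Longrightarrow> N k a b = A t a b"
  shows "((\<lambda>s. pfaffian n (A s)) has_real_derivative
      (\<Sum>k<2*n. q k * (pfaffian n (P k) - pfaffian n (A t)) + p k * (pfaffian n (N k) - pfaffian n (A t))))
      (at t within S)"
proof -
  let ?\<Pi> = "{\<pi>. \<pi> permutes {0..<2*n}}"
  define G where "G \<pi> = (\<Sum>k<2*n. q k * (pf_term n (P k) \<pi> - pf_term n (A t) \<pi>)
      + p k * (pf_term n (N k) \<pi> - pf_term n (A t) \<pi>))" for \<pi>
  have der_term: "((\<lambda>s. pf_term n (A s) \<pi>) has_real_derivative G \<pi>) (at t within S)" if "\<pi> \<in> ?\<Pi>" for \<pi>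
  proof -
    have \<pi>: "\<pi> permutes {0..<2*n}" using that by simp
    have "((\<lambda>s. pf_term n (A s) \<pi>) has_real_derivative
       (\<Sum>i<n. (\<Sum>k\<in>{\<pi> (2*i), \<pi> (2*i+1)}.
           q k * (P k (\<pi> (2*i)) (\<pi> (2*i+1)) - A t (\<pi> (2*i)) (\<pi> (2*i+1)))
         + p k * (N k (\<pi> (2*i)) (\<pi> (2*i+1)) - A t (\<pi> (2*i)) (\<pi> (2*i+1))))
         * (\<Prod>j\<in>{..<n}-{i}. A t (\<pi> (2*j)) (\<pi> (2*j+1))))) (at t within S)" (is "(_ has_real_derivative ?G) _")
      unfolding pf_term_def using permutes_even_odd[OF \<pi>]
      by (intro has_real_derivative_prod_within, rule der) auto
    moreover have "G \<pi> = ?G"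
      unfolding G_def sum.distrib distrib_right
      by (intro arg_cong2[where f="(+)"] pf_term_row_sum \<pi> P N)
    ultimately show ?thesis by simp
  qed
  have "((\<lambda>s. (\<Sum>\<pi>\<in>?\<Pi>. of_int (sign \<pi>) * pf_term n (A s) \<pi>) / (2 ^ n * fact n)) has_real_derivative
      (\<Sum>\<pi>\<in>?\<Pi>. of_int (sign \<pi>) * G \<pi>) / (2 ^ n * fact n)) (at t within S)"
    by (intro DERIV_cdivide DERIV_sum DERIV_cmult der_term)
  moreover have "(\<Sum>\<pi>\<in>?\<Pi>. of_int (sign \<pi>) * G \<pi>) =
     (\<Sum>k<2*n. q k * (pf_sum n (P k) - pf_sum n (A t)) + p k * (pf_sum n (N k) - pf_sum n (A t)))"
  proof -
    have "(\<Sum>\<pi>\<in>?\<Pi>. of_int (sign \<pi>) * G \<pi>) =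
      (\<Sum>k<2*n. \<Sum>\<pi>\<in>?\<Pi>. of_int (sign \<pi>) * (q k * (pf_term n (P k) \<pi> - pf_term n (A t) \<pi>)
      + p k * (pf_term n (N k) \<pi> - pf_term n (A t) \<pi>)))"
      unfolding G_def sum_distrib_left by (rule sum.swap)
    also have "\<dots> = (\<Sum>k<2*n. q k * (pf_sum n (P k) - pf_sum n (A t)) + p k * (pf_sum n (N k) - pf_sum n (A t)))"
      unfolding pf_sum_def sum_subtractf[symmetric] sum_distrib_left sum.distrib[symmetric]
      by (intro sum.cong refl) (simp only: right_diff_distrib distrib_left mult.left_commute)
    finally show ?thesis .
  qed
  moreover have "\<dots> / (2 ^ n * fact n) = (\<Sum>k<2*n. q k * (pfaffian n (P k) - pfaffian n (A t))
      + p k * (pfaffian n (N k) - pfaffian n (A t)))"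
    unfolding sum_divide_distrib pfaffian_eq_pf_sum
    by (intro sum.cong refl) (simp only: diff_divide_distrib[symmetric] times_divide_eq_right add_divide_distrib)
  ultimately show ?thesis
    by (simp only: pfaffian_eq_pf_sum pf_sum_def)
qed

text \<open>There are \<open>(2n)!\<close> terms of size at most 1, and the normalising constant is
  at least 1. Uniqueness later asks only for some bound uniform in time and end points.\<close>

lemma pfaffian_bound:
  assumes "\<And>a b. a < 2*n \<Longrightarrow> b < 2*n \<Longrightarrow> \<bar>A a b\<bar> \<le> 1"
  shows "\<bar>pfaffian n A\<bar> \<le> fact (2*n)"
proof -
  have "\<bar>pf_term n A \<pi>\<bar> \<le> 1" if \<pi>: "\<pi> permutes {0..<2*n}" for \<pi>
    unfolding pf_term_def abs_prod
    using permutes_even_odd[OF \<pi>] assms by (intro prod_le_1) auto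
  then have "\<bar>pf_sum n A\<bar> \<le> (\<Sum>\<pi> | \<pi> permutes {0..<2*n}. 1)"
    unfolding pf_sum_def
    by (intro order.trans[OF sum_abs] sum_mono) (auto simp: abs_mult sign_def)
  also have "\<dots> = fact (2*n)"
    using card_permutations[of "{0..<2*n}" "2*n"] by simp
  finally have *: "\<bar>pf_sum n A\<bar> \<le> fact (2*n)" .
  have "1 \<le> (2::real) ^ n * fact n"
    using mult_mono[of 1 "2^n" 1 "fact n :: real"] by (simp add: fact_ge_1)
  then show ?thesis using *
    unfolding pfaffian_eq_pf_sum abs_divide
    using divide_left_mono[of 1 "2 ^ n * fact n" "\<bar>pf_sum n A\<bar>"] by simp
qed

section \<open>Splitting a pair of indices off the Pfaffian\<close>

lemma sum_eq_0_of_sign_reversing: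
  fixes f :: "'a \<Rightarrow> real"
  assumes "bij_betw g S S" "\<And>x. x \<in> S \<Longrightarrow> f (g x) = - f x"
  shows "sum f S = 0"
proof -
  have "sum f S = (\<Sum>x\<in>S. f (g x))" using sum.reindex_bij_betw[OF assms(1), of f] by simp
  also have "\<dots> = - sum f S" using assms(2) by (simp add: sum_negf)
  finally show ?thesis by simp
qed

lemma permutes_last_two_fixed:
  fixes n :: nat
  shows "{\<pi>. \<pi> permutes {0..<2*n+2} \<and> \<pi> (2*n) = 2*n \<and> \<pi> (2*n+1) = 2*n+1} = {\<pi>. \<pi> permutes {0..<2*n}}"
  (is "?L = ?R")
proof (intro Set.equalityI subsetI)
  fix \<pi> assume "\<pi> \<in> ?L"
  then have \<pi>: "\<pi> permutes {0..<2*n+2}" "\<pi> (2*n) = 2*n" "\<pi> (2*n+1) = 2*n+1" by auto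
  have "\<pi> permutes {0..<2*n}"
  proof (rule permutes_superset[OF \<pi>(1)])
    fix x assume "x \<in> {0..<2*n+2} - {0..<2*n}"
    then have "x = 2*n \<or> x = 2*n+1" by auto
    then show "\<pi> x = x" using \<pi> by auto
  qed
  then show "\<pi> \<in> ?R" by simp
next
  fix \<pi> assume "\<pi> \<in> ?R"
  then have \<pi>: "\<pi> permutes {0..<2*n}" by simp
  then show "\<pi> \<in> ?L"
    using permutes_subset[OF \<pi>, of "{0..<2*n+2}"] permutes_not_in[OF \<pi>] by auto
qed

text \<open>Exchanging the pairs at positions \<open>i\<close> and \<open>n\<close> takes two
  transpositions, so the sign is 1; if \<open>i = n\<close> both are the identity. Composition with
  \<open>\<beta>\<close> only reorders the factors of a term.\<close>

lemma block_swap: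
  fixes i n :: nat
  assumes "i \<le> n"
  defines "\<beta> \<equiv> Transposition.transpose (2*i) (2*n) \<circ> Transposition.transpose (2*i+1) (2*n+1)"
  shows "\<beta> permutes {0..<2*n+2}" "sign \<beta> = 1"
    "\<beta> (2*j) = 2 * Transposition.transpose i n j" "\<beta> (2*j+1) = 2 * Transposition.transpose i n j + 1"
    "\<beta> \<circ> \<beta> = id"
proof -
  have *: "Transposition.transpose (2*i) (2*n) permutes {0..<2*n+2}" "Transposition.transpose (2*i+1) (2*n+1) permutes {0..<2*n+2}"
    using assms(1) by (intro permutes_swap_id; simp)+
  show "\<beta> permutes {0..<2*n+2}"
    unfolding \<beta>_def using * by (intro permutes_compose)
  show "sign \<beta> = 1"
    unfolding \<beta>_def by (subst sign_compose) (auto simp: permutation_swap_id sign_swap_id)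
  have ne: "2*j \<noteq> 2*k+1" for j k :: nat by presburger
  show even: "\<beta> (2*j) = 2 * Transposition.transpose i n j" for j
    using ne[of j i] ne[of j n] unfolding \<beta>_def by (auto simp: Transposition.transpose_def)
  show odd: "\<beta> (2*j+1) = 2 * Transposition.transpose i n j + 1" for j
    using ne[of i j] ne[of n j] ne[of i n] ne[of n n] ne[of n i] ne[of i i]
    unfolding \<beta>_def by (auto simp: Transposition.transpose_def)
  show "\<beta> \<circ> \<beta> = id"
  proof
    fix x :: nat
    have "x = 2 * (x div 2) \<or> x = 2 * (x div 2) + 1" by presburger
    then obtain j where "x = 2 * j \<or> x = 2 * j + 1" by blast
    then show "(\<beta> \<circ> \<beta>) x = id x" using even odd by auto
  qed
qed

text \<open>Permutations that do not match the last two indices cancel in pairs, because on them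
  the transposition of these indices does not change the product.\<close>

lemma pfaffian_last_pair:
  assumes anti: "\<And>a b. a < 2*n+2 \<Longrightarrow> b < 2*n+2 \<Longrightarrow> A b a = - A a b"
    and ratio: "\<And>j. j < 2*n \<Longrightarrow> A j (2*n+1) = s * A j (2*n)"
  shows "pfaffian (Suc n) A = A (2*n) (2*n+1) * pfaffian n A"
proof -
  define S where "S = {\<pi>. \<pi> permutes {0..<2*n+2}}"
  define f where "f \<pi> = of_int (sign \<pi>) * pf_term (Suc n) A \<pi>" for \<pi>
  \<comment> \<open>\<open>pr i\<close> matches \<open>2*n\<close> with \<open>2*n+1\<close> in the
    pair at position \<open>i\<close>; \<open>un\<close> holds the permutations that match them with
    other indices.\<close>
  define pr where "pr i = {\<pi>\<in>S. {\<pi> (2*i), \<pi> (2*i+1)} = {2*n, 2*n+1}}" for i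
  define un where "un = S - (\<Union>i\<le>n. pr i)"
  have finS: "finite S" unfolding S_def by (intro finite_permutations) simp
  have perm: "permutation \<pi>" if "\<pi> \<in> S" for \<pi>
    using that permutation_permutes unfolding S_def by blast
  have S2: "\<pi> permutes {0..<2 * Suc n}" if "\<pi> \<in> S" for \<pi> using that by (simp add: S_def)
  have injS: "\<pi> x = \<pi> y \<longleftrightarrow> x = y" if "\<pi> \<in> S" for \<pi> x y
    using permutes_inj[OF S2[OF that]] by (simp add: inj_eq)
  have pfS: "pf_sum (Suc n) A = sum f S"
    unfolding pf_sum_def f_def S_def by simp
  have disj: "pr i \<inter> pr j = {}" if "i \<noteq> j" for i j
  proof -
    have False if \<pi>: "\<pi> \<in> pr i" "\<pi> \<in> pr j" for \<pi>
    proof -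
      have "\<pi> (2*i) \<in> {\<pi> (2*j), \<pi> (2*j+1)}" using \<pi> unfolding pr_def by auto
      moreover have "\<pi> \<in> S" using \<pi> unfolding pr_def by auto
      ultimately have "2*i = 2*j \<or> 2*i = 2*j+1" using injS by auto
      then show False using \<open>i \<noteq> j\<close> by presburger
    qed
    then show ?thesis by blast
  qed

  define \<tau> where "\<tau> = Transposition.transpose (2*n) (2*n+1)"
  have \<tau>: "\<tau> \<in> S" unfolding \<tau>_def S_def by (simp add: permutes_swap_id)
  have sign\<tau>: "sign \<tau> = -1" by (simp add: \<tau>_def sign_swap_id)
  have \<tau>\<tau>: "\<tau> (\<tau> x) = x" for x by (simp add: \<tau>_def)

  have un0: "sum f un = 0"
  proof (rule sum_eq_0_of_sign_reversing[where g = "\<lambda>\<pi>. \<tau> \<circ> \<pi>"])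
    have pr_iff: "\<tau> \<circ> \<pi> \<in> pr i \<longleftrightarrow> \<pi> \<in> pr i" if "\<pi> \<in> S" for \<pi> i
    proof -
      have "\<tau> x = 2*n \<longleftrightarrow> x = 2*n+1" "\<tau> x = 2*n+1 \<longleftrightarrow> x = 2*n" for x
        by (auto simp: \<tau>_def Transposition.transpose_def)
      then show ?thesis
        using \<tau> that unfolding pr_def S_def by (auto simp: permutes_compose doubleton_eq_iff)
    qed
    have mem: "\<tau> \<circ> \<pi> \<in> un" if "\<pi> \<in> un" for \<pi>
      using that pr_iff[of \<pi>] \<tau> unfolding un_def by (auto simp: S_def permutes_compose)
    show "bij_betw (\<lambda>\<pi>. \<tau> \<circ> \<pi>) un un"
      by (rule bij_betwI[where g = "\<lambda>\<pi>. \<tau> \<circ> \<pi>"]) (auto simp: mem fun_eq_iff \<tau>\<tau>)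
    fix \<pi> assume "\<pi> \<in> un"
    then have \<pi>: "\<pi> \<in> S" "\<And>i. i \<le> n \<Longrightarrow> \<pi> \<notin> pr i" unfolding un_def by auto
    \<comment> \<open>The index \<open>2*n+1\<close> is folded onto \<open>2*n\<close> by
      \<open>g\<close> at the cost of the factor \<open>s\<close>, recorded by \<open>c\<close>.
      Each index occurs once in a term, so a term without the pair \<open>2*n\<close>,
      \<open>2*n+1\<close> acquires exactly one factor \<open>s\<close>.\<close>
    define c where "c a = (if a = 2*n+1 then s else 1)" for a
    define g where "g a = (if a = 2*n+1 then 2*n else a)" for a
    have A_factor: "A a b = c a * c b * A (g a) (g b)"
      if "a < 2*n+2" "b < 2*n+2" "a \<noteq> b" "{a,b} \<noteq> {2*n, 2*n+1}" for a b
    proof -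
      have "\<not> (a = 2*n \<and> b = 2*n+1)" "\<not> (a = 2*n+1 \<and> b = 2*n)" using that(4) by auto
      then have "a = 2*n+1 \<and> b < 2*n \<or> b = 2*n+1 \<and> a < 2*n \<or> a \<noteq> 2*n+1 \<and> b \<noteq> 2*n+1"
        using that(1-3) by linarith
      then consider "a = 2*n+1" "b < 2*n" | "b = 2*n+1" "a < 2*n" | "a \<noteq> 2*n+1" "b \<noteq> 2*n+1"
        by blast
      then show ?thesis
      proof cases
        case 1
        have "A a b = - A b (2*n+1)" using anti[of b a] that 1 by simp
        also have "\<dots> = s * (- A b (2*n))" using ratio[of b] 1 by simp
        also have "- A b (2*n) = A (2*n) b" using anti[of b "2*n"] 1 by simp
        finally show ?thesis using 1 by (simp add: c_def g_def)
      qed (use ratio[of a] in \<open>auto simp: c_def g_def\<close>)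
    qed
    have val: "pf_term (Suc n) A \<rho> = s * (\<Prod>i<Suc n. A (g (\<rho> (2*i))) (g (\<rho> (2*i+1))))"
      if \<rho>: "\<rho> \<in> S" "\<And>i. i \<le> n \<Longrightarrow> \<rho> \<notin> pr i" for \<rho>
    proof -
      have "pf_term (Suc n) A \<rho> = (\<Prod>i<Suc n. c (\<rho> (2*i)) * c (\<rho> (2*i+1)) * A (g (\<rho> (2*i))) (g (\<rho> (2*i+1))))"
        unfolding pf_term_def
      proof (intro prod.cong refl A_factor)
        fix i assume i: "i \<in> {..<Suc n}"
        show "\<rho> (2*i) < 2*n+2" "\<rho> (2*i+1) < 2*n+2" "\<rho> (2*i) \<noteq> \<rho> (2*i+1)"
          using permutes_even_odd[OF S2[OF \<rho>(1)], of i] i by auto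
        show "{\<rho> (2*i), \<rho> (2*i+1)} \<noteq> {2*n, 2*n+1}" using \<rho>(2)[of i] \<rho>(1) i unfolding pr_def by auto
      qed
      also have "\<dots> = (\<Prod>m<2*Suc n. c (\<rho> m)) * (\<Prod>i<Suc n. A (g (\<rho> (2*i))) (g (\<rho> (2*i+1))))"
        unfolding prod_even_odd by (rule prod.distrib)
      also have "(\<Prod>m<2*Suc n. c (\<rho> m)) = (\<Prod>m<2*Suc n. c m)"
        using prod.permute[OF S2[OF \<rho>(1)], of c] by (simp add: o_def atLeast0LessThan)
      also have "\<dots> = s" by (simp add: c_def)
      finally show ?thesis .
    qed
    \<comment> \<open>After folding, \<open>\<tau>\<close> is invisible: the term is unchanged while
      the sign flips.\<close>
    have "g (\<tau> x) = g x" for x by (auto simp: g_def \<tau>_def Transposition.transpose_def)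
    moreover have "\<tau> \<circ> \<pi> \<in> S" "\<And>i. i \<le> n \<Longrightarrow> \<tau> \<circ> \<pi> \<notin> pr i"
      using mem[OF \<open>\<pi> \<in> un\<close>] unfolding un_def by auto
    ultimately have "pf_term (Suc n) A (\<tau> \<circ> \<pi>) = pf_term (Suc n) A \<pi>"
      using val[of \<pi>] val[of "\<tau> \<circ> \<pi>"] \<pi> by (simp del: prod.lessThan_Suc)
    then show "f (\<tau> \<circ> \<pi>) = - f \<pi>"
      unfolding f_def using sign_compose[OF perm[OF \<tau>] perm[OF \<pi>(1)]] sign\<tau> by simp
  qed

  \<comment> \<open>By \<open>block_swap\<close>, every position contributes as much as the last
    one.\<close>
  have pr_n: "sum f (pr i) = sum f (pr n)" if i: "i \<le> n" for i
  proof -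
    define \<beta> where "\<beta> = Transposition.transpose (2*i) (2*n) \<circ> Transposition.transpose (2*i+1) (2*n+1)"
    note \<beta> = block_swap[OF i, folded \<beta>_def]
    have \<beta>S: "\<beta> \<in> S" using \<beta>(1) by (simp add: S_def)
    have "bij_betw (\<lambda>\<pi>. \<pi> \<circ> \<beta>) (pr n) (pr i)"
    proof (rule bij_betwI[where g = "\<lambda>\<pi>. \<pi> \<circ> \<beta>"])
      show "(\<lambda>\<pi>. \<pi> \<circ> \<beta>) \<in> pr n \<rightarrow> pr i" "(\<lambda>\<pi>. \<pi> \<circ> \<beta>) \<in> pr i \<rightarrow> pr n"
        using \<beta>(3)[of i] \<beta>(3)[of n] \<beta>(4)[of i] \<beta>(4)[of n] permutes_compose[OF \<beta>(1)]
        unfolding pr_def S_def by auto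
    qed (use \<beta>(5) in \<open>auto simp: o_assoc[symmetric]\<close>)
    then have "sum f (pr i) = (\<Sum>\<pi>\<in>pr n. f (\<pi> \<circ> \<beta>))"
      using sum.reindex_bij_betw[of "\<lambda>\<pi>. \<pi> \<circ> \<beta>" "pr n" "pr i" f] by simp
    also have "\<dots> = sum f (pr n)"
    proof (intro sum.cong refl)
      fix \<pi> assume "\<pi> \<in> pr n"
      then have \<pi>: "\<pi> \<in> S" by (simp add: pr_def)
      have "pf_term (Suc n) A (\<pi> \<circ> \<beta>) = (\<Prod>j<Suc n. A (\<pi> (2 * Transposition.transpose i n j)) (\<pi> (2 * Transposition.transpose i n j + 1)))"
        unfolding pf_term_def o_apply \<beta>(3,4) ..
      also have "\<dots> = pf_term (Suc n) A \<pi>"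
        unfolding pf_term_def
        using prod.permute[of "Transposition.transpose i n" "{..<Suc n}" "\<lambda>j. A (\<pi> (2*j)) (\<pi> (2*j+1))"] i
        by (simp add: permutes_swap_id o_def)
      finally show "f (\<pi> \<circ> \<beta>) = f \<pi>"
        unfolding f_def using sign_compose[OF perm[OF \<pi>] perm[OF \<beta>S]] \<beta>(2) by simp
    qed
    finally show ?thesis .
  qed

  define fx where "fx = {\<pi>. \<pi> permutes {0..<2*n}}"
  have fx: "fx = {\<pi>\<in>S. \<pi> (2*n) = 2*n \<and> \<pi> (2*n+1) = 2*n+1}"
    unfolding fx_def S_def using permutes_last_two_fixed[of n] by auto
  \<comment> \<open>The last pair can be filled in two orders, \<open>fx\<close> and
    \<open>sw\<close>. Passing from one to the other flips both the sign of the permutation and the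
    sign of the entry, so the contributions agree.\<close>
  define sw where "sw = {\<pi>\<in>S. \<pi> (2*n) = 2*n+1 \<and> \<pi> (2*n+1) = 2*n}"
  have "pr n = fx \<union> sw" "fx \<inter> sw = {}"
    unfolding fx sw_def pr_def by (auto simp: doubleton_eq_iff)
  then have "sum f (pr n) = sum f fx + sum f sw"
    using finS by (simp add: sum.union_disjoint fx sw_def)
  also have "sum f sw = (\<Sum>\<pi>\<in>fx. f (\<pi> \<circ> \<tau>))"
  proof -
    have "bij_betw (\<lambda>\<pi>. \<pi> \<circ> \<tau>) fx sw"
    proof (rule bij_betwI[where g = "\<lambda>\<pi>. \<pi> \<circ> \<tau>"])
      show "(\<lambda>\<pi>. \<pi> \<circ> \<tau>) \<in> fx \<rightarrow> sw" "(\<lambda>\<pi>. \<pi> \<circ> \<tau>) \<in> sw \<rightarrow> fx"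
        using \<tau> unfolding fx sw_def S_def by (auto simp: permutes_compose \<tau>_def)
    qed (auto simp: fun_eq_iff \<tau>\<tau>)
    then show ?thesis
      using sum.reindex_bij_betw[of "\<lambda>\<pi>. \<pi> \<circ> \<tau>" fx sw f] by simp
  qed
  also have "\<dots> = sum f fx"
  proof (intro sum.cong refl)
    fix \<pi> assume "\<pi> \<in> fx"
    then have \<pi>: "\<pi> \<in> S" "\<pi> (2*n) = 2*n" "\<pi> (2*n+1) = 2*n+1" unfolding fx by auto
    have "\<tau> (2*j) = 2*j" "\<tau> (2*j+1) = 2*j+1" if "j < n" for j
      using that unfolding \<tau>_def by (auto simp: Transposition.transpose_def)
    then have "pf_term (Suc n) A (\<pi> \<circ> \<tau>) = - pf_term (Suc n) A \<pi>"
      using \<pi>(2,3) anti[of "2*n" "2*n+1"] by (simp add: pf_term_def \<tau>_def)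
    then show "f (\<pi> \<circ> \<tau>) = f \<pi>"
      unfolding f_def using sign_compose[OF perm[OF \<pi>(1)] perm[OF \<tau>]] sign\<tau> by simp
  qed
  also have "sum f fx = A (2*n) (2*n+1) * pf_sum n A"
    unfolding pf_sum_def sum_distrib_left fx_def[symmetric]
  proof (intro sum.cong refl)
    fix \<pi> assume "\<pi> \<in> fx"
    then have "\<pi> (2*n) = 2*n" "\<pi> (2*n+1) = 2*n+1" unfolding fx by auto
    then show "f \<pi> = A (2*n) (2*n+1) * (of_int (sign \<pi>) * pf_term n A \<pi>)"
      by (simp add: f_def pf_term_def)
  qed
  finally have prn: "sum f (pr n) = 2 * (A (2*n) (2*n+1) * pf_sum n A)" by simp

  have "S = un \<union> (\<Union>i\<le>n. pr i)" unfolding un_def pr_def by auto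
  then have "sum f S = sum f un + sum f (\<Union>i\<le>n. pr i)"
    using finS unfolding un_def by (metis finite_Un sum.union_disjoint Diff_disjoint Int_commute un_def)
  also have "sum f (\<Union>i\<le>n. pr i) = (\<Sum>i\<le>n. sum f (pr i))"
    using finS disj by (intro sum.UNION_disjoint) (auto simp: pr_def)
  also have "\<dots> = (\<Sum>i\<le>n. sum f (pr n))" by (rule sum.cong[OF refl], rule pr_n) simp
  \<comment> \<open>The factor counts \<open>n + 1\<close> positions and two orders; it is the
    quotient of the normalising constants for \<open>Suc n\<close> and \<open>n\<close>.\<close>
  also have "\<dots> = 2 * (real n + 1) * (A (2*n) (2*n+1) * pf_sum n A)"
    by (simp add: prn)
  finally have "pf_sum (Suc n) A = 2 * (real n + 1) * (A (2*n) (2*n+1) * pf_sum n A)"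
    by (simp add: un0 pfS)
  then show ?thesis
    unfolding pfaffian_eq_pf_sum
    by (simp add: field_simps del: of_nat_Suc) (simp add: algebra_simps)
qed

definition skew :: "(nat \<Rightarrow> nat \<Rightarrow> real) \<Rightarrow> nat \<Rightarrow> nat \<Rightarrow> real" where
  "skew U a b = (if a < b then U a b else if b < a then - U b a else 0)"

text \<open>In the rows before the last two, column \<open>2*n+1\<close> is \<open>s (2*n)\<close>
  times column \<open>2*n\<close>, so \<open>pfaffian_last_pair\<close> splits off the factor
  \<open>s (2*n)\<close>.\<close>

lemma pfaffian_multiplicative:
  "pfaffian n (skew (\<lambda>a b. \<Prod>k\<in>{a..<b}. s k)) = (\<Prod>i<n. s (2*i))"
proof (induction n)
  case (Suc n)
  have "pfaffian (Suc n) (skew (\<lambda>a b. \<Prod>k\<in>{a..<b}. s k))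
      = skew (\<lambda>a b. \<Prod>k\<in>{a..<b}. s k) (2*n) (2*n+1) * pfaffian n (skew (\<lambda>a b. \<Prod>k\<in>{a..<b}. s k))"
    by (rule pfaffian_last_pair[where s = "s (2*n)"]) (auto simp: skew_def)
  moreover have "skew (\<lambda>a b. \<Prod>k\<in>{a..<b}. s k) (2*n) (2*n+1) = s (2*n)"
    by (simp add: skew_def)
  ultimately show ?case using Suc.IH by (simp add: mult.commute)
qed simp

text \<open>An even permutation moves the indices \<open>k\<close> and \<open>k+1\<close> to the
  end, where \<open>pfaffian_last_pair\<close> applies with ratio 1 and last entry 1. The map
  \<open>h\<close> lists the remaining indices in order.\<close>

lemma pfaffian_drop_pair:
  assumes anti: "\<And>a b. a < 2*n+2 \<Longrightarrow> b < 2*n+2 \<Longrightarrow> A b a = - A a b"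
    and k: "k < 2*n+1" and one: "A k (k+1) = 1"
    and eq: "\<And>j. j < 2*n+2 \<Longrightarrow> j \<noteq> k \<Longrightarrow> j \<noteq> k+1 \<Longrightarrow> A j (k+1) = A j k"
  defines "h \<equiv> \<lambda>j. if j < k then j else j + 2"
  shows "pfaffian (Suc n) A = pfaffian n (\<lambda>a b. A (h a) (h b))"
proof -
  \<comment> \<open>\<open>c\<close> is the cyclic shift of the indices from \<open>k\<close> to
    \<open>2*n+1\<close>. Its square sends the last two indices to \<open>k\<close> and
    \<open>k+1\<close>, and being a square it is even.\<close>
  define c where "c j = (if j < k \<or> j \<ge> 2*n+2 then j else if j = 2*n+1 then k else j+1)" for j
  have c: "c permutes {0..<2*n+2}"
    by (rule inj_imp_permutes) (use k in \<open>auto simp: c_def inj_on_def split: if_splits\<close>)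
  define \<rho> where "\<rho> = c \<circ> c"
  have \<rho>: "\<rho> permutes {0..<2*Suc n}" unfolding \<rho>_def using permutes_compose[OF c c] by simp
  have "permutation c" using c permutation_permutes by blast
  then have sign: "sign \<rho> = 1" unfolding \<rho>_def by (simp add: sign_compose)
  have \<rho>h: "\<rho> j = h j" if "j < 2*n" for j using that k by (auto simp: \<rho>_def c_def h_def)
  have \<rho>k: "\<rho> (2*n) = k" "\<rho> (2*n+1) = k+1" using k by (auto simp: \<rho>_def c_def)
  have "pfaffian (Suc n) A = pfaffian (Suc n) (\<lambda>a b. A (\<rho> a) (\<rho> b))"
    using pfaffian_permute[OF \<rho>, of A] sign by simp
  also have "\<dots> = A (\<rho> (2*n)) (\<rho> (2*n+1)) * pfaffian n (\<lambda>a b. A (\<rho> a) (\<rho> b))"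
  proof (rule pfaffian_last_pair[where s = 1])
    have lt: "\<rho> a < 2*n+2" if "a < 2*n+2" for a
      using permutes_in_image[OF \<rho>, of a] that by auto
    show "A (\<rho> b) (\<rho> a) = - A (\<rho> a) (\<rho> b)" if "a < 2*n+2" "b < 2*n+2" for a b
      using that lt anti by blast
    show "A (\<rho> j) (\<rho> (2*n+1)) = 1 * A (\<rho> j) (\<rho> (2*n))" if "j < 2*n" for j
      unfolding \<rho>k using that by (simp only: mult_1_left, intro eq) (auto simp: \<rho>h h_def)
  qed
  also have "\<dots> = pfaffian n (\<lambda>a b. A (h a) (h b))"
    unfolding \<rho>k one mult_1_left by (rule pfaffian_cong) (simp add: \<rho>h)
  finally show ?thesis .
qed

text \<open>\<open>\<rho>0\<close> moves the even indices and \<open>\<sigma>\<close> exchanges the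
  two indices of each block. Alternating them moves whole blocks, and each occurs twice, so the
  signs cancel. Hence a Pfaffian built from 2x2 blocks does not depend on the order in which the
  sites are listed.\<close>

lemma block_permutation:
  fixes f :: "nat \<Rightarrow> nat"
  assumes f: "f permutes {0..<n}"
  defines "\<rho> \<equiv> \<lambda>m. 2 * f (m div 2) + m mod 2"
  shows "\<rho> permutes {0..<2*n}" and "sign \<rho> = 1"
proof -
  define \<rho>0 where "\<rho>0 m = (if even m then 2 * f (m div 2) else m)" for m :: nat
  define \<sigma> where "\<sigma> m = (if m < 2*n then if even m then m + 1 else m - 1 else m)" for m :: nat
  have f_lt: "f m < n \<longleftrightarrow> m < n" for m using permutes_in_image[OF f, of m] by simp
  have f_ge: "f m = m" if "m \<ge> n" for m using permutes_not_in[OF f] that by simp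
  have f_eq: "f x = f y \<longleftrightarrow> x = y" for x y using permutes_inj[OF f] by (simp add: inj_eq)
  have \<rho>0: "\<rho>0 permutes {0..<2*n}"
  proof (rule inj_imp_permutes)
    show "inj_on \<rho>0 {0..<2*n}"
    proof (rule inj_onI)
      fix x y assume "\<rho>0 x = \<rho>0 y"
      then show "x = y"
        unfolding \<rho>0_def by (auto simp: f_eq split: if_splits elim!: evenE)
    qed
    show "\<rho>0 x \<in> {0..<2*n}" if "x \<in> {0..<2*n}" for x
      using that f_lt[of "x div 2"] unfolding \<rho>0_def by auto
    show "\<rho>0 x = x" if "x \<notin> {0..<2*n}" for x
      using that f_ge[of "x div 2"] unfolding \<rho>0_def by auto
  qed simp
  have \<sigma>\<sigma>: "\<sigma> (\<sigma> m) = m" for m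
    unfolding \<sigma>_def by (auto elim!: evenE oddE)
  have \<sigma>: "\<sigma> permutes {0..<2*n}"
  proof (rule inj_imp_permutes)
    show "inj_on \<sigma> {0..<2*n}" by (rule inj_onI) (metis \<sigma>\<sigma>)
    show "\<sigma> x \<in> {0..<2*n}" if "x \<in> {0..<2*n}" for x
      using that unfolding \<sigma>_def by (auto elim!: evenE)
  qed (auto simp: \<sigma>_def)
  have \<rho>: "\<rho> = \<rho>0 \<circ> (\<sigma> \<circ> (\<rho>0 \<circ> \<sigma>))"
  proof
    fix m :: nat
    show "\<rho> m = (\<rho>0 \<circ> (\<sigma> \<circ> (\<rho>0 \<circ> \<sigma>))) m"
    proof (cases "even m")
      case True
      then obtain j where m: "m = 2*j" by (elim evenE)
      have "\<sigma> (\<rho>0 (\<sigma> m)) = m"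
      proof (cases "j < n")
        case False
        then show ?thesis using f_ge[of j] by (simp add: m \<sigma>_def \<rho>0_def)
      qed (simp add: m \<sigma>_def \<rho>0_def)
      then show ?thesis by (simp add: \<rho>_def \<rho>0_def m)
    next
      case False
      then obtain j where m: "m = 2*j+1" by (elim oddE)
      have "\<sigma> (\<rho>0 (\<sigma> m)) = 2 * f j + 1"
      proof (cases "j < n")
        case True
        then show ?thesis using f_lt[of j] by (simp add: m \<sigma>_def \<rho>0_def)
      next
        case False
        then show ?thesis using f_ge[of j] by (simp add: m \<sigma>_def \<rho>0_def)
      qed
      then show ?thesis by (simp add: \<rho>_def \<rho>0_def m)
    qed
  qed
  show "\<rho> permutes {0..<2*n}"
    unfolding \<rho> by (intro permutes_compose \<rho>0 \<sigma>)
  have p: "permutation \<rho>0" "permutation \<sigma>" using \<rho>0 \<sigma> permutation_permutes by blast+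
  show "sign \<rho> = 1"
    unfolding \<rho> using p by (simp add: sign_compose permutation_compose mult.left_commute)
qed

section \<open>Interval products and the generator\<close>

definition spin :: "real \<Rightarrow> int set \<Rightarrow> config \<Rightarrow> real" where
  "spin \<theta> I \<eta> = (\<Prod>x\<in>I. if \<eta> x then - \<theta> else 1)"

definition toggle :: "'a \<Rightarrow> 'a set \<Rightarrow> 'a set" where
  "toggle a I = (if a \<in> I then I - {a} else insert a I)"

lemma mem_toggle: "x \<in> toggle a I \<longleftrightarrow> (x \<in> I) \<noteq> (x = a)"
  by (auto simp: toggle_def)

lemma sigma_fn_eq_spin: "sigma_fn \<theta> y z \<eta> = spin \<theta> {y..<z} \<eta>"
proof -
  have "{x. y \<le> x \<and> x < z \<and> \<eta> x} = {x \<in> {y..<z}. \<eta> x}" by auto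
  then show ?thesis
    by (simp add: sigma_fn_def count_in_def spin_def prod.If_cases Int_def)
qed

lemma spin_empty [simp]: "spin \<theta> {} \<eta> = 1"
  by (simp add: spin_def)

lemma spin_union:
  "finite I \<Longrightarrow> finite J \<Longrightarrow> I \<inter> J = {} \<Longrightarrow> spin \<theta> (I \<union> J) \<eta> = spin \<theta> I \<eta> * spin \<theta> J \<eta>"
  by (simp add: spin_def prod.union_disjoint)

lemma spin_split_two:
  assumes "finite I" "a \<noteq> b"
  shows "spin \<theta> I \<eta> = (if a \<in> I \<and> \<eta> a then - \<theta> else 1) * (if b \<in> I \<and> \<eta> b then - \<theta> else 1) * spin \<theta> (I - {a,b}) \<eta>"
proof -
  have "spin \<theta> I \<eta> = spin \<theta> (I \<inter> {a,b}) \<eta> * spin \<theta> (I - {a,b}) \<eta>"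
    using assms spin_union[of "I \<inter> {a,b}" "I - {a,b}" \<theta> \<eta>] by (simp add: Int_Diff_Un Int_Diff_disjoint)
  moreover have "spin \<theta> (I \<inter> {a,b}) \<eta> = (if a \<in> I \<and> \<eta> a then - \<theta> else 1) * (if b \<in> I \<and> \<eta> b then - \<theta> else 1)"
    using assms(2) by (simp add: spin_def Int_insert_right)
  ultimately show ?thesis by simp
qed

text \<open>The weight \<open>-\<theta>\<close> is made for this. The decisive case is that of two
  particles with \<open>b\<close> in \<open>I\<close>: the average is
  \<open>\<theta> * 1 + (1 - \<theta>) * (-\<theta>) = \<theta>^2\<close>, the weight of two counted
  particles. If \<open>b\<close> is not in \<open>I\<close>, the jumping particle is no longer
  counted.\<close>

lemma spin_jump:
  assumes I: "finite I" and ab: "a \<noteq> b"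
  shows "\<theta> * spin \<theta> I (ann_upd a b \<eta>) + (1 - \<theta>) * spin \<theta> I (coal_upd a b \<eta>)
    = spin \<theta> (if a \<in> I \<longleftrightarrow> b \<in> I then I else toggle a I) \<eta>"
proof -
  let ?I' = "if a \<in> I \<longleftrightarrow> b \<in> I then I else toggle a I"
  have I': "finite ?I'" using I by (auto simp: toggle_def)
  have rest: "?I' - {a,b} = I - {a,b}" by (auto simp: toggle_def)
  have "spin \<theta> (I - {a,b}) (ann_upd a b \<eta>) = spin \<theta> (I - {a,b}) \<eta>"
    "spin \<theta> (I - {a,b}) (coal_upd a b \<eta>) = spin \<theta> (I - {a,b}) \<eta>"
    unfolding spin_def ann_upd_def coal_upd_def by (auto intro!: prod.cong)
  then show ?thesis
    unfolding spin_split_two[OF I ab] spin_split_two[OF I' ab] rest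
    using ab by (cases "\<eta> a"; cases "\<eta> b"; cases "a \<in> I"; cases "b \<in> I")
      (simp_all add: ann_upd_def coal_upd_def toggle_def algebra_simps)
qed

lemma spin_bound:
  assumes "0 \<le> \<theta>" "\<theta> \<le> 1"
  shows "\<bar>spin \<theta> I \<eta>\<bar> \<le> 1"
  unfolding spin_def abs_prod using assms by (intro prod_le_1) auto

lemma cylinder_spin: "finite I \<Longrightarrow> cylinder (spin \<theta> I)"
  unfolding cylinder_def spin_def by (intro exI[of _ I]) (auto intro!: prod.cong)

lemma measurable_spin [measurable]: "spin \<theta> I \<in> borel_measurable config_space"
proof -
  have [measurable]: "(\<lambda>\<eta>. \<eta> x) \<in> measurable config_space (count_space UNIV)" for x
    unfolding config_space_def by (rule measurable_component_singleton) simp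
  show ?thesis unfolding spin_def[abs_def] by measurable
qed

lemma space_config_space [simp]: "space config_space = UNIV"
  by (simp add: config_space_def space_PiM)

text \<open>The union of the intervals \<open>[y\<^sub>0,y\<^sub>1), [y\<^sub>2,y\<^sub>3), \<dots>\<close>, described by a parity so that it makes
  sense without any ordering of the end points.\<close>

definition par :: "nat \<Rightarrow> (nat \<Rightarrow> int) \<Rightarrow> int set" where
  "par n y = {x. odd (card {k. k < 2*n \<and> y k \<le> x})}"

lemma par_0 [simp]: "par 0 y = {}"
  by (simp add: par_def)

text \<open>The number of end points is even, so the parity vanishes both to the left and to the
  right of all of them.\<close>

lemma finite_par: "finite (par n y)"
proof (rule finite_subset)
  show "par n y \<subseteq> (\<Union>k<2*n. \<Union>j<2*n. {y k..<y j})"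
  proof
    fix x assume "x \<in> par n y"
    then have odd: "odd (card {k. k < 2*n \<and> y k \<le> x})" by (simp add: par_def)
    have "\<exists>k<2*n. y k \<le> x"
    proof (rule ccontr)
      assume "\<not> ?thesis"
      then have empty: "{k. k < 2*n \<and> y k \<le> x} = {}" by auto
      show False using odd unfolding empty by simp
    qed
    moreover have "\<exists>j<2*n. x < y j"
    proof (rule ccontr)
      assume "\<not> ?thesis"
      then have full: "{k. k < 2*n \<and> y k \<le> x} = {..<2*n}" by auto
      show False using odd unfolding full by simp
    qed
    ultimately show "x \<in> (\<Union>k<2*n. \<Union>j<2*n. {y k..<y j})" by auto
  qed
qed auto

lemma card_le_remove:
  fixes y :: "nat \<Rightarrow> int"
  assumes "k < m"
  shows "card {j. j < m \<and> y j \<le> x} = card {j. j < m \<and> j \<noteq> k \<and> y j \<le> x} + of_bool (y k \<le> x)"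
proof (cases "y k \<le> x")
  case True
  then have "{j. j < m \<and> y j \<le> x} = insert k {j. j < m \<and> j \<noteq> k \<and> y j \<le> x}" using assms by auto
  then show ?thesis using True by simp
next
  case False
  then have "{j. j < m \<and> y j \<le> x} = {j. j < m \<and> j \<noteq> k \<and> y j \<le> x}" using assms by auto
  then show ?thesis using False by simp
qed

lemma mem_par_upd:
  assumes "k < 2*n"
  shows "x \<in> par n (y(k := z)) \<longleftrightarrow> ((x \<in> par n y) \<longleftrightarrow> (y k \<le> x \<longleftrightarrow> z \<le> x))"
proof -
  have "{j. j < 2*n \<and> j \<noteq> k \<and> (y(k := z)) j \<le> x} = {j. j < 2*n \<and> j \<noteq> k \<and> y j \<le> x}" by auto
  then show ?thesis
    unfolding par_def mem_Collect_eq card_le_remove[OF assms, of y] card_le_remove[OF assms, of "y(k := z)"]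
    by auto
qed

lemma par_right: "k < 2*n \<Longrightarrow> par n (y(k := y k + 1)) = toggle (y k) (par n y)"
  by (rule set_eqI) (auto simp: mem_par_upd mem_toggle)

lemma par_left: "k < 2*n \<Longrightarrow> par n (y(k := y k - 1)) = toggle (y k - 1) (par n y)"
  by (rule set_eqI) (auto simp: mem_par_upd mem_toggle)

text \<open>From \<open>x - 1\<close> to \<open>x\<close> the count grows by the number of end
  points at \<open>x\<close>, which is 0 or 1 because they are distinct.\<close>

lemma par_step:
  assumes inj: "inj_on y {..<2*n}"
  shows "(x \<in> par n y \<longleftrightarrow> x - 1 \<in> par n y) \<longleftrightarrow> x \<notin> y ` {..<2*n}"
proof (cases "x \<in> y ` {..<2*n}")
  case True
  then obtain k where k: "k < 2*n" "x = y k" by auto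
  have "j = k" if "j < 2*n" "y j = x" for j using inj that k by (auto simp: inj_on_def)
  then have "{j. j < 2*n \<and> y j \<le> x} = insert k {j. j < 2*n \<and> y j \<le> x - 1}"
    using k by (auto simp: order.order_iff_strict)
  then have "card {j. j < 2*n \<and> y j \<le> x} = Suc (card {j. j < 2*n \<and> y j \<le> x - 1})"
    using k by simp
  then show ?thesis using True by (simp add: par_def)
next
  case False
  then have "{j. j < 2*n \<and> y j \<le> x} = {j. j < 2*n \<and> y j \<le> x - 1}"
    by (auto simp: order.order_iff_strict)
  then show ?thesis using False by (simp add: par_def)
qed

text \<open>From \<open>y (2*n)\<close> on, all \<open>2*n\<close> earlier end points have been
  counted, so their parity is even and the last interval is simply appended.\<close>

lemma par_Suc:
  assumes mono: "\<And>i j. i \<le> j \<Longrightarrow> j < 2*n+2 \<Longrightarrow> y i \<le> y j"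
  shows "par (Suc n) y = par n y \<union> {y (2*n)..<y (2*n+1)}" "par n y \<inter> {y (2*n)..<y (2*n+1)} = {}"
proof -
  have c: "card {j. j < 2 * Suc n \<and> y j \<le> x} = card {j. j < 2*n \<and> y j \<le> x}
      + of_bool (y (2*n) \<le> x) + of_bool (y (2*n+1) \<le> x)" for x
  proof -
    have "{j. j < 2*n+2 \<and> j \<noteq> 2*n+1 \<and> y j \<le> x} = {j. j < 2*n+1 \<and> y j \<le> x}"
      "{j. j < 2*n+1 \<and> j \<noteq> 2*n \<and> y j \<le> x} = {j. j < 2*n \<and> y j \<le> x}" by auto
    then show ?thesis
      using card_le_remove[of "2*n+1" "2*n+2" y x] card_le_remove[of "2*n" "2*n+1" y x] by simp
  qed
  have off: "x \<notin> par n y" if "y (2*n) \<le> x" for x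
  proof -
    have "{j. j < 2*n \<and> y j \<le> x} = {..<2*n}" using that by (auto intro: order_trans[OF mono[of _ "2*n"]])
    then show ?thesis by (simp add: par_def)
  qed
  have le: "y (2*n) \<le> y (2*n+1)" using mono by simp
  show "par n y \<inter> {y (2*n)..<y (2*n+1)} = {}" using off by auto
  show "par (Suc n) y = par n y \<union> {y (2*n)..<y (2*n+1)}"
  proof (rule set_eqI)
    fix x
    have "x \<in> par (Suc n) y \<longleftrightarrow> odd (card {j. j < 2*n \<and> y j \<le> x} + of_bool (y (2*n) \<le> x) + of_bool (y (2*n+1) \<le> x))"
      unfolding par_def mem_Collect_eq c ..
    also have "\<dots> \<longleftrightarrow> x \<in> par n y \<union> {y (2*n)..<y (2*n+1)}"
      using off[of x] le unfolding par_def by auto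
    finally show "x \<in> par (Suc n) y \<longleftrightarrow> x \<in> par n y \<union> {y (2*n)..<y (2*n+1)}" .
  qed
qed

lemma par_1:
  assumes "y 0 \<le> y 1"
  shows "par 1 y = {y 0..<y 1}"
proof -
  have "y i \<le> y j" if "i \<le> j" "j < 2*0+2" for i j
  proof -
    have "i = j \<or> i = 0 \<and> j = 1" using that by linarith
    then show ?thesis using assms by auto
  qed
  from par_Suc(1)[OF this] show ?thesis by simp
qed

text \<open>Two coinciding end points add 0 or 2 to the count and leave the parity alone.\<close>

lemma par_drop_pair:
  assumes k: "k < 2*n+1" and eq: "y k = y (k+1)"
  shows "par (Suc n) y = par n (\<lambda>j. y (if j < k then j else j + 2))"
proof -
  define h where "h j = (if j < k then j else j + 2)" for j :: nat
  have c: "card {j. j < 2*n+2 \<and> y j \<le> x} = card {j. j < 2*n \<and> y (h j) \<le> x} + 2 * of_bool (y k \<le> x)" for x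
  proof -
    have inj: "inj h" by (auto simp: inj_def h_def split: if_splits)
    have "j \<in> h ` {..<2*n}" if "j < 2*n+2" "j \<noteq> k" "j \<noteq> k+1" for j
    proof (cases "j < k")
      case True
      then have "j = h j" "j < 2*n" using k by (auto simp: h_def)
      then show ?thesis by blast
    next
      case False
      then have "j = h (j - 2)" "j - 2 < 2*n" using that by (auto simp: h_def)
      then show ?thesis by blast
    qed
    moreover have "h j < 2*n+2" "h j \<noteq> k" "h j \<noteq> k+1" if "j < 2*n" for j
      using that by (auto simp: h_def)
    ultimately have img: "h ` {..<2*n} = {..<2*n+2} - {k, k+1}" by (auto simp del: One_nat_def)
    have "{j. j < 2*n+2 \<and> y j \<le> x} = {j\<in>h ` {..<2*n}. y j \<le> x} \<union> (if y k \<le> x then {k, k+1} else {})"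
      unfolding img using k eq by auto
    also have "{j\<in>h ` {..<2*n}. y j \<le> x} = h ` {j. j < 2*n \<and> y (h j) \<le> x}" by auto
    finally have "{j. j < 2*n+2 \<and> y j \<le> x} = h ` {j. j < 2*n \<and> y (h j) \<le> x} \<union> (if y k \<le> x then {k, k+1} else {})" .
    moreover have "h ` {j. j < 2*n \<and> y (h j) \<le> x} \<inter> {k, k+1} = {}" using img by auto
    moreover have "card (h ` {j. j < 2*n \<and> y (h j) \<le> x}) = card {j. j < 2*n \<and> y (h j) \<le> x}"
      by (intro card_image inj_on_subset[OF inj]) simp
    ultimately show ?thesis
      by (cases "y k \<le> x") (simp_all add: card_Un_disjoint del: Int_insert_right)
  qed
  show ?thesis
    unfolding par_def using c by (simp add: h_def)
qed

section \<open>Action of the generator on interval products\<close>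

lemma infsum_finite_support:
  fixes f :: "'a \<Rightarrow> real"
  assumes "finite A" "\<And>x. x \<notin> A \<Longrightarrow> f x = 0"
  shows "infsum f UNIV = sum f A"
proof -
  have "infsum f UNIV = infsum f A" by (rule infsum_cong_neutral) (use assms in auto)
  then show ?thesis using assms by simp
qed

text \<open>A jump between sites of equal membership averages to no change, so by
  \<open>par_step\<close> only jumps across an end point count. A jump from \<open>x\<close> to
  \<open>x - 1\<close> across the end point at \<open>x\<close> toggles \<open>x\<close>, which
  moves this end point to \<open>x + 1\<close>. Hence end points move against the particles, to the
  right at rate \<open>q\<close> and to the left at rate \<open>p\<close>.\<close>

lemma generator_spin:
  assumes inj: "inj_on y {..<2*n}"
  shows "generator \<theta> p q (spin \<theta> (par n y)) \<eta> =
    (\<Sum>k<2*n. q (y k) * (spin \<theta> (par n (y(k := y k + 1))) \<eta> - spin \<theta> (par n y) \<eta>)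
            + p (y k) * (spin \<theta> (par n (y(k := y k - 1))) \<eta> - spin \<theta> (par n y) \<eta>))"
proof -
  let ?I = "par n y"
  let ?Y = "y ` {..<2*n}"
  have R: "\<theta> * spin \<theta> ?I (ann_upd x (x - 1) \<eta>) + (1 - \<theta>) * spin \<theta> ?I (coal_upd x (x - 1) \<eta>)
      = spin \<theta> (if x \<in> ?Y then toggle x ?I else ?I) \<eta>" for x
    using spin_jump[OF finite_par, of x "x - 1" \<theta> n y \<eta>] par_step[OF inj, of x] by simp
  have L: "\<theta> * spin \<theta> ?I (ann_upd (x - 1) x \<eta>) + (1 - \<theta>) * spin \<theta> ?I (coal_upd (x - 1) x \<eta>)
      = spin \<theta> (if x \<in> ?Y then toggle (x - 1) ?I else ?I) \<eta>" for x
  proof -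
    have "(x - 1 \<in> ?I \<longleftrightarrow> x \<in> ?I) \<longleftrightarrow> x \<notin> ?Y" using par_step[OF inj, of x] by blast
    then show ?thesis using spin_jump[OF finite_par, of "x - 1" x \<theta> n y \<eta>] by simp
  qed
  have "generator \<theta> p q (spin \<theta> ?I) \<eta> =
      (\<Sum>x\<in>?Y. q x * (spin \<theta> (toggle x ?I) \<eta> - spin \<theta> ?I \<eta>))
    + (\<Sum>x\<in>?Y. p x * (spin \<theta> (toggle (x - 1) ?I) \<eta> - spin \<theta> ?I \<eta>))"
    unfolding generator_def R L
    by (intro arg_cong2[where f = "(+)"]; subst infsum_finite_support[of ?Y]) auto
  also have "\<dots> = (\<Sum>k<2*n. q (y k) * (spin \<theta> (par n (y(k := y k + 1))) \<eta> - spin \<theta> ?I \<eta>))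
    + (\<Sum>k<2*n. p (y k) * (spin \<theta> (par n (y(k := y k - 1))) \<eta> - spin \<theta> ?I \<eta>))"
    using inj by (simp add: sum.reindex par_right par_left)
  finally show ?thesis by (simp add: sum.distrib)
qed

section \<open>The duality equations\<close>

text \<open>Adding \<open>g\<close> to the claimed bound, or subtracting it, gives a function that
  starts at 0 and has nonnegative derivative. This is one step of the Picard iteration.\<close>

lemma real_derivative_bound_power:
  fixes g :: "real \<Rightarrow> real"
  assumes der: "\<And>s. s \<ge> 0 \<Longrightarrow> (g has_real_derivative g' s) (at s within {0..})"
    and bound: "\<And>s. s \<ge> 0 \<Longrightarrow> \<bar>g' s\<bar> \<le> c * s ^ m"
    and g0: "g 0 = 0" and t: "t \<ge> 0"
  shows "\<bar>g t\<bar> \<le> c * t ^ Suc m / Suc m"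
proof -
  have pow: "((\<lambda>s. c * s ^ Suc m / Suc m) has_real_derivative c * s ^ m) (at s within {0..})" for s
    using DERIV_cdivide[OF DERIV_cmult[OF DERIV_pow[of "Suc m" s "{0..}"], of c], of "real (Suc m)"]
    by (simp del: of_nat_Suc)
  have nonneg: "0 \<le> f t" if f: "\<And>s. s \<ge> 0 \<Longrightarrow> (f has_real_derivative f' s) (at s within {0..})"
    and f': "\<And>s. s \<ge> 0 \<Longrightarrow> 0 \<le> f' s" and f0: "f 0 = 0" for f f' :: "real \<Rightarrow> real"
  proof -
    have "f 0 \<le> f t"
    proof (rule DERIV_nonneg_imp_increasing_open[OF t])
      \<comment> \<open>At an interior point the derivative within the half-line is an ordinary one;
        at 0 continuity is enough.\<close>
      fix x :: real assume x: "0 < x"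
      have "(f has_real_derivative f' x) (at x within {0<..})"
        using f[of x] x by (intro DERIV_subset[where t = "{0<..}"]) auto
      then show "\<exists>d. (f has_real_derivative d) (at x) \<and> 0 \<le> d"
        using x f'[of x] by (auto simp: at_within_open[of x "{0<..}"])
    next
      have "continuous_on {0..} f" by (rule DERIV_continuous_on) (use f in auto)
      then show "continuous_on {0..t} f" by (rule continuous_on_subset) auto
    qed
    then show ?thesis using f0 by simp
  qed
  have "0 \<le> c * t ^ Suc m / Suc m - g t"
    by (rule nonneg[OF DERIV_diff[OF pow der]]) (use bound g0 in \<open>auto simp: abs_le_iff\<close>)
  moreover have "0 \<le> c * t ^ Suc m / Suc m + g t"
  proof (rule nonneg[OF DERIV_add[OF pow der]])
    fix s :: real assume "s \<ge> 0"
    then show "0 \<le> c * s ^ m + g' s" using bound[of s] by (auto simp: abs_le_iff)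
  qed (use g0 in auto)
  ultimately show ?thesis by (simp add: abs_le_iff)
qed

text \<open>Each integration improves the estimate by one power, to
  \<open>B * (R * s)^m / m!\<close>, which tends to 0 as a term of the exponential series. In
  \<open>flow\<close> only the supremum over \<open>G\<close> appears, so \<open>D'\<close> may
  refer to points outside \<open>G\<close> as long as \<open>D\<close> is controlled there.\<close>

lemma linear_flow_unique:
  fixes D D' :: "real \<Rightarrow> 'a \<Rightarrow> real"
  assumes der: "\<And>y s. y \<in> G \<Longrightarrow> s \<ge> 0 \<Longrightarrow> ((\<lambda>s. D s y) has_real_derivative D' s y) (at s within {0..})"
    and init: "\<And>y. y \<in> G \<Longrightarrow> D 0 y = 0"
    and bound: "\<And>y s. y \<in> G \<Longrightarrow> s \<ge> 0 \<Longrightarrow> \<bar>D s y\<bar> \<le> B"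
    and flow: "\<And>y s c. y \<in> G \<Longrightarrow> s \<ge> 0 \<Longrightarrow> (\<And>z. z \<in> G \<Longrightarrow> \<bar>D s z\<bar> \<le> c) \<Longrightarrow> \<bar>D' s y\<bar> \<le> R * c"
    and y: "y \<in> G" and t: "t \<ge> 0"
  shows "D t y = 0"
proof -
  have iter: "\<bar>D s z\<bar> \<le> B * (R * s) ^ m / fact m" if "z \<in> G" "s \<ge> 0" for z s m
    using that
  proof (induction m arbitrary: z s)
    case 0
    then show ?case using bound by simp
  next
    case (Suc m)
    have "\<bar>D s z\<bar> \<le> (R * (B * R ^ m / fact m)) * s ^ Suc m / Suc m"
    proof (rule real_derivative_bound_power[OF der[OF Suc.prems(1)]])
      fix r :: real assume r: "r \<ge> 0"
      have "\<bar>D' r z\<bar> \<le> R * (B * (R * r) ^ m / fact m)"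
        using flow[OF Suc.prems(1) r] Suc.IH r by blast
      then show "\<bar>D' r z\<bar> \<le> R * (B * R ^ m / fact m) * r ^ m"
        by (simp add: power_mult_distrib mult_ac)
    qed (use init Suc.prems in auto)
    then show ?case by (simp add: power_mult_distrib field_simps)
  qed
  have "(\<lambda>m. B * (inverse (fact m) * (R * t) ^ m)) \<longlonglongrightarrow> B * 0"
    by (intro tendsto_mult tendsto_const summable_LIMSEQ_zero summable_exp)
  then have "\<bar>D t y\<bar> \<le> B * 0"
    by (rule LIMSEQ_le_const) (use iter[OF y t] in \<open>auto simp: field_simps\<close>)
  then show ?thesis by simp
qed

text \<open>Adjacent intervals are disjoint, which gives a fixed configuration the form required by
  \<open>pfaffian_multiplicative\<close>.\<close>

lemma spin_telescope:
  assumes mono: "\<And>i j. i \<le> j \<Longrightarrow> j < m \<Longrightarrow> y i \<le> y j" and "a \<le> b" "b < m"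
  shows "spin \<theta> {y a..<y b} \<eta> = (\<Prod>k\<in>{a..<b}. spin \<theta> {y k..<y (Suc k)} \<eta>)"
  using assms(2,3)
proof (induction b rule: dec_induct)
  case (step b)
  have "y a \<le> y b" "y b \<le> y (Suc b)" using mono step by auto
  then have "{y a..<y (Suc b)} = {y a..<y b} \<union> {y b..<y (Suc b)}" by auto
  then show ?case using step by (simp add: spin_union)
qed simp

lemma spin_par_mono:
  assumes mono: "\<And>i j. i \<le> j \<Longrightarrow> j < 2*n \<Longrightarrow> y i \<le> y j"
  shows "spin \<theta> (par n y) \<eta> = (\<Prod>i<n. spin \<theta> {y (2*i)..<y (2*i+1)} \<eta>)"
  using assms
proof (induction n)
  case (Suc n)
  have mono: "y i \<le> y j" if "i \<le> j" "j < 2*n+2" for i j using Suc.prems that by simp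
  have "par (Suc n) y = par n y \<union> {y (2*n)..<y (2*n+1)}" "par n y \<inter> {y (2*n)..<y (2*n+1)} = {}"
    using par_Suc[of n y] mono by blast+
  moreover have "spin \<theta> (par n y) \<eta> = (\<Prod>i<n. spin \<theta> {y (2*i)..<y (2*i+1)} \<eta>)"
    by (rule Suc.IH, rule mono) auto
  ultimately show ?case
    by (simp add: spin_union finite_par)
qed simp

section \<open>Evolution of expected interval products and of their Pfaffian\<close>

locale mixed_particle_law =
  fixes \<theta> :: real and p q :: "int \<Rightarrow> real" and \<eta> :: config and \<mu> :: "real \<Rightarrow> config measure" and C :: real
  assumes \<theta>0: "0 \<le> \<theta>" and \<theta>1: "\<theta> \<le> 1"
    and rates: "\<And>x. 0 \<le> p x" "\<And>x. 0 \<le> q x" "\<And>x. p x \<le> C" "\<And>x. q x \<le> C"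
    and law: "is_process_law \<theta> p q \<eta> \<mu>"
begin

lemma prob: "t \<ge> 0 \<Longrightarrow> prob_space (\<mu> t)"
  and sets_\<mu>: "t \<ge> 0 \<Longrightarrow> sets (\<mu> t) = sets config_space"
  and \<mu>_0: "\<mu> 0 = return config_space \<eta>"
  using law by (auto simp: is_process_law_def)

lemma forward: "cylinder F \<Longrightarrow> t \<ge> 0 \<Longrightarrow>
    ((\<lambda>s. \<integral>\<omega>. F \<omega> \<partial>(\<mu> s)) has_real_derivative (\<integral>\<omega>. generator \<theta> p q F \<omega> \<partial>(\<mu> t))) (at t within {0..})"
  using law by (auto simp: is_process_law_def)

lemma measurable_\<mu>: "t \<ge> 0 \<Longrightarrow> f \<in> borel_measurable config_space \<Longrightarrow> f \<in> borel_measurable (\<mu> t)"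
  using measurable_cong_sets[OF sets_\<mu>[of t] refl] by auto

lemma integrable_spin: "t \<ge> 0 \<Longrightarrow> integrable (\<mu> t) (spin \<theta> I)"
  by (intro finite_measure.integrable_const_bound[where B = 1] prob_space.finite_measure prob measurable_\<mu>)
    (auto simp: spin_bound[OF \<theta>0 \<theta>1])

definition E :: "real \<Rightarrow> int set \<Rightarrow> real" where
  "E t I = (\<integral>\<omega>. spin \<theta> I \<omega> \<partial>(\<mu> t))"

lemma E_bound: "t \<ge> 0 \<Longrightarrow> \<bar>E t I\<bar> \<le> 1"
proof -
  assume t: "t \<ge> 0"
  interpret M: prob_space "\<mu> t" by (rule prob[OF t])
  have "\<bar>E t I\<bar> \<le> (\<integral>\<omega>. \<bar>spin \<theta> I \<omega>\<bar> \<partial>(\<mu> t))" unfolding E_def by (rule integral_abs_bound)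
  also have "\<dots> \<le> (\<integral>\<omega>. 1 \<partial>(\<mu> t))"
    by (intro integral_mono integrable_abs integrable_spin t) (auto simp: spin_bound[OF \<theta>0 \<theta>1])
  finally show ?thesis by (simp add: M.prob_space)
qed

lemma E_empty: "t \<ge> 0 \<Longrightarrow> E t {} = 1"
  by (simp add: E_def prob_space.prob_space[OF prob])

lemma E_0: "E 0 I = spin \<theta> I \<eta>"
  unfolding E_def \<mu>_0 by (rule integral_return) auto

lemma E_derivative:
  assumes inj: "inj_on y {..<2*n}" and t: "t \<ge> 0"
  shows "((\<lambda>s. E s (par n y)) has_real_derivative
     (\<Sum>k<2*n. q (y k) * (E t (par n (y(k := y k + 1))) - E t (par n y))
            + p (y k) * (E t (par n (y(k := y k - 1))) - E t (par n y)))) (at t within {0..})"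
proof -
  note [simp] = integrable_spin[OF t]
  have "(\<integral>\<omega>. generator \<theta> p q (spin \<theta> (par n y)) \<omega> \<partial>(\<mu> t)) =
     (\<Sum>k<2*n. q (y k) * (E t (par n (y(k := y k + 1))) - E t (par n y))
            + p (y k) * (E t (par n (y(k := y k - 1))) - E t (par n y)))"
    unfolding generator_spin[OF inj] E_def
    by (subst Bochner_Integration.integral_sum) (auto intro!: sum.cong)
  then show ?thesis
    using forward[OF cylinder_spin[OF finite_par] t, of \<theta> n y] unfolding E_def by simp
qed

definition K :: "real \<Rightarrow> int \<Rightarrow> int \<Rightarrow> real" where
  "K t y z = E t {y..<z}"

lemma K_derivative:
  assumes yz: "y < z" and t: "t \<ge> 0"
  shows "((\<lambda>s. K s y z) has_real_derivative
     (q y * (K t (y + 1) z - K t y z) + p y * (K t (y - 1) z - K t y z))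
   + (q z * (K t y (z + 1) - K t y z) + p z * (K t y (z - 1) - K t y z))) (at t within {0..})"
proof -
  define v where "v = (\<lambda>k::nat. if k = 0 then y else z)"
  have inj: "inj_on v {..<2*1}" using yz by (auto simp: inj_on_def v_def)
  \<comment> \<open>As \<open>y < z\<close>, a unit move can at most make the two ends meet, so
    \<open>par_1\<close> covers all five sets.\<close>
  have "par 1 v = {y..<z}" "par 1 (v(0 := y + 1)) = {y+1..<z}" "par 1 (v(0 := y - 1)) = {y-1..<z}"
    "par 1 (v(Suc 0 := z + 1)) = {y..<z+1}" "par 1 (v(Suc 0 := z - 1)) = {y..<z-1}"
    using yz by (subst par_1; simp add: v_def)+
  then show ?thesis
    using E_derivative[OF inj t] by (simp add: numeral_2_eq_2 v_def K_def)
qed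

definition M :: "real \<Rightarrow> (nat \<Rightarrow> int) \<Rightarrow> nat \<Rightarrow> nat \<Rightarrow> real" where
  "M t y = skew (\<lambda>a b. K t (y a) (y b))"

text \<open>The Pfaffian obeys the linear equations of \<open>E_derivative\<close>, because an entry
  depends on two end points only and strict ordering makes \<open>K_derivative\<close> available for
  it.\<close>

lemma pfaffian_M_derivative:
  assumes strict: "\<And>i j. i < j \<Longrightarrow> j < 2*n \<Longrightarrow> y i < y j" and t: "t \<ge> 0"
  shows "((\<lambda>s. pfaffian n (M s y)) has_real_derivative
     (\<Sum>k<2*n. q (y k) * (pfaffian n (M t (y(k := y k + 1))) - pfaffian n (M t y))
            + p (y k) * (pfaffian n (M t (y(k := y k - 1))) - pfaffian n (M t y)))) (at t within {0..})"
proof (rule pfaffian_has_derivative)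
  fix a b assume ab: "a < 2*n" "b < 2*n" "a \<noteq> b"
  have *: "((\<lambda>s. K s (y i) (y j)) has_real_derivative
     (\<Sum>k\<in>{i,j}. q (y k) * (K t ((y(k := y k + 1)) i) ((y(k := y k + 1)) j) - K t (y i) (y j))
        + p (y k) * (K t ((y(k := y k - 1)) i) ((y(k := y k - 1)) j) - K t (y i) (y j)))) (at t within {0..})"
    if "i < j" "j < 2*n" for i j
    using K_derivative[OF strict[OF that] t] that(1) by simp
  show "((\<lambda>s. M s y a b) has_real_derivative
      (\<Sum>k\<in>{a,b}. q (y k) * (M t (y(k := y k + 1)) a b - M t y a b)
                + p (y k) * (M t (y(k := y k - 1)) a b - M t y a b))) (at t within {0..})"
  proof (cases "a < b")
    case True
    then show ?thesis using *[OF True ab(2)] by (simp add: M_def skew_def)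
  next
    case False
    then have ba: "b < a" using ab by simp
    show ?thesis using DERIV_minus[OF *[OF ba ab(1)]] ba by (simp add: M_def skew_def algebra_simps)
  qed
qed (auto simp: M_def skew_def)

text \<open>When consecutive end points meet, both sides lose this pair: the set by
  \<open>par_drop_pair\<close>, the Pfaffian by \<open>pfaffian_drop_pair\<close>, since an empty
  interval has expectation 1 and the two columns agree in all other rows.\<close>

lemma E_par_boundary:
  assumes t: "t \<ge> 0" and mono: "\<And>i j. i \<le> j \<Longrightarrow> j < 2 * Suc n \<Longrightarrow> y i \<le> y j"
    and k: "k < 2*n+1" "y k = y (k+1)"
    and IH: "\<And>z. (\<And>i j. i \<le> j \<Longrightarrow> j < 2*n \<Longrightarrow> z i \<le> z j) \<Longrightarrow> E t (par n z) = pfaffian n (M t z)"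
  shows "E t (par (Suc n) y) = pfaffian (Suc n) (M t y)"
proof -
  define h where "h j = (if j < k then j else j + 2)" for j :: nat
  have h: "h i < h j \<longleftrightarrow> i < j" for i j by (auto simp: h_def)
  have "pfaffian (Suc n) (M t y) = pfaffian n (\<lambda>a b. M t y (h a) (h b))"
    unfolding h_def
  proof (rule pfaffian_drop_pair)
    show "M t y k (k+1) = 1"
      using k E_empty[OF t] by (simp add: M_def skew_def K_def)
    show "M t y j (k+1) = M t y j k" if "j \<noteq> k" "j \<noteq> k+1" for j
      using that k(2) by (auto simp: M_def skew_def)
  qed (use k(1) in \<open>auto simp: M_def skew_def\<close>)
  also have "(\<lambda>a b. M t y (h a) (h b)) = M t (\<lambda>j. y (h j))"
    by (simp add: M_def skew_def h fun_eq_iff)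
  also have "pfaffian n \<dots> = E t (par n (\<lambda>j. y (h j)))"
    by (rule IH[symmetric], rule mono) (auto simp: h_def)
  also have "par n (\<lambda>j. y (h j)) = par (Suc n) y"
    using par_drop_pair[OF k] by (simp add: h_def)
  finally show ?thesis ..
qed

text \<open>The start is deterministic, so expectations at time 0 are themselves products, and both
  sides reduce to the product over the intervals from \<open>y (2*i)\<close> to
  \<open>y (2*i+1)\<close>.\<close>

lemma pfaffian_M_0:
  assumes mono: "\<And>i j. i \<le> j \<Longrightarrow> j < 2*n \<Longrightarrow> y i \<le> y j"
  shows "pfaffian n (M 0 y) = E 0 (par n y)"
proof -
  have telescope: "spin \<theta> {y i..<y j} \<eta> = (\<Prod>k\<in>{i..<j}. spin \<theta> {y k..<y (Suc k)} \<eta>)"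
    if "i \<le> j" "j < 2*n" for i j
    using spin_telescope[of "2*n" y i j] mono that by blast
  have "pfaffian n (M 0 y) = pfaffian n (skew (\<lambda>a b. \<Prod>k\<in>{a..<b}. spin \<theta> {y k..<y (Suc k)} \<eta>))"
  proof (rule pfaffian_cong)
    fix a b assume "a < 2*n" "b < 2*n"
    then show "M 0 y a b = skew (\<lambda>a b. \<Prod>k\<in>{a..<b}. spin \<theta> {y k..<y (Suc k)} \<eta>) a b"
      using telescope[of a b] telescope[of b a] by (simp add: M_def skew_def K_def E_0)
  qed
  also have "\<dots> = E 0 (par n y)"
    by (simp add: pfaffian_multiplicative E_0 spin_par_mono[OF mono])
  finally show ?thesis .
qed

text \<open>Induction on the number of pairs: the case \<open>n\<close> supplies the boundary values
  for \<open>n + 1\<close>. In the interior the difference \<open>D\<close> of the two sides solves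
  a linear system with zero initial value and vanishes by \<open>linear_flow_unique\<close>.\<close>

theorem E_par_eq_pfaffian:
  assumes "t \<ge> 0" and "\<And>i j. i \<le> j \<Longrightarrow> j < 2*n \<Longrightarrow> y i \<le> y j"
  shows "E t (par n y) = pfaffian n (M t y)"
  using assms
proof (induction n arbitrary: t y)
  case 0
  then show ?case by (simp add: E_empty)
next
  case (Suc n)
  \<comment> \<open>\<open>Mn\<close> is the closed cell of weakly ordered end points,
    \<open>G\<close> the part with strict inequalities.\<close>
  define Mn where "Mn = {y::nat \<Rightarrow> int. \<forall>i j. i \<le> j \<longrightarrow> j < 2 * Suc n \<longrightarrow> y i \<le> y j}"
  define G where "G = {y::nat \<Rightarrow> int. \<forall>i j. i < j \<longrightarrow> j < 2 * Suc n \<longrightarrow> y i < y j}"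
  define D where "D s y = E s (par (Suc n) y) - pfaffian (Suc n) (M s y)" for s y
  have GD: "y i < y j" if "y \<in> G" "i < j" "j < 2 * Suc n" for y i j using that unfolding G_def by blast
  have MD: "y i \<le> y j" if "y \<in> Mn" "i \<le> j" "j < 2 * Suc n" for y i j using that unfolding Mn_def by blast
  have zero: "D s y = 0" if "y \<in> Mn" "y \<notin> G" "s \<ge> 0" for s y
  proof -
    have "\<exists>k<2*n+1. y k = y (k+1)"
    proof (rule ccontr)
      assume "\<not> ?thesis"
      then have step: "y k < y (Suc k)" if "Suc k < 2 * Suc n" for k
        using MD[OF \<open>y \<in> Mn\<close>, of k "Suc k"] that by (auto simp: less_le)
      have "y i < y j" if "i < j" "j < 2 * Suc n" for i j
        using that
      proof (induction j)
        case (Suc j)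
        then show ?case using step[of j] by (cases "i = j") (auto intro: less_trans)
      qed simp
      then show False using \<open>y \<notin> G\<close> unfolding G_def by blast
    qed
    then obtain k where "k < 2*n+1" "y k = y (k+1)" by blast
    then show ?thesis
      unfolding D_def using E_par_boundary[OF \<open>s \<ge> 0\<close> MD[OF \<open>y \<in> Mn\<close>]] Suc.IH[OF \<open>s \<ge> 0\<close>] by simp
  qed
  define D' where "D' s y = (\<Sum>k<2 * Suc n. q (y k) * (D s (y(k := y k + 1)) - D s y)
            + p (y k) * (D s (y(k := y k - 1)) - D s y))" for s y
  have D0: "D s y = 0" if y: "y \<in> G" and s: "s \<ge> 0" for s y
  \<comment> \<open>\<open>B\<close> adds the bounds for \<open>E\<close> and for the Pfaffian. In
    \<open>R\<close>, each of the \<open>2n+2\<close> end points has two moves of rate at most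
    \<open>C\<close>, and each difference is at most twice the supremum.\<close>
  proof (rule linear_flow_unique[where D = D and D' = D' and G = G and B = "1 + fact (2 * Suc n)"
        and R = "2 * Suc n * (4 * C)"])
    fix y s assume y: "y \<in> G" and s: "(0::real) \<le> s"
    have inj: "inj_on y {..<2 * Suc n}"
      by (rule linorder_inj_onI') (use GD[OF y] in force)
    show "((\<lambda>s. D s y) has_real_derivative D' s y) (at s within {0..})"
      unfolding D_def
      by (rule DERIV_cong[OF DERIV_diff[OF E_derivative[OF inj s] pfaffian_M_derivative[OF GD[OF y] s]]])
        (simp_all only: D'_def D_def sum_subtractf[symmetric], auto intro!: sum.cong simp: algebra_simps)
    have "\<bar>pfaffian (Suc n) (M s y)\<bar> \<le> fact (2 * Suc n)"
      using E_bound[OF s] by (intro pfaffian_bound) (auto simp: M_def skew_def K_def)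
    then show "\<bar>D s y\<bar> \<le> 1 + fact (2 * Suc n)"
      unfolding D_def using E_bound[OF s, of "par (Suc n) y"] by linarith
    fix c assume c: "\<And>z. z \<in> G \<Longrightarrow> \<bar>D s z\<bar> \<le> c"
    have c0: "0 \<le> c" using c[OF y] by linarith
    have cM: "\<bar>D s z\<bar> \<le> c" if "z \<in> Mn" for z
      using c[of z] zero[OF that _ s] c0 by (cases "z \<in> G") auto
    \<comment> \<open>Strictly ordered integers differ by at least 1, so a unit move of one of them
      stays in the closed cell, where \<open>D\<close> is either bounded by \<open>c\<close> or
      zero.\<close>
    have up: "y(k := y k + d) \<in> Mn" if "\<bar>d\<bar> \<le> 1" for k d
    proof -
      have "(y(k := y k + d)) i \<le> (y(k := y k + d)) j" if "i \<le> j" "j < 2 * Suc n" for i j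
        using GD[OF y, of i j] that \<open>\<bar>d\<bar> \<le> 1\<close> by (cases "i = j") auto
      then show ?thesis unfolding Mn_def by blast
    qed
    have "\<bar>D' s y\<bar> \<le> (\<Sum>k<2 * Suc n. 4 * C * c)"
      unfolding D'_def
    proof (rule order.trans[OF sum_abs], rule sum_mono)
      fix k
      have "\<bar>D s (y(k := y k + 1)) - D s y\<bar> \<le> 2 * c" "\<bar>D s (y(k := y k - 1)) - D s y\<bar> \<le> 2 * c"
        using cM[OF up[of 1 k]] cM[OF up[of "-1" k]] c[OF y] by (simp_all add: abs_le_iff)
      then have "q (y k) * \<bar>D s (y(k := y k + 1)) - D s y\<bar> \<le> C * (2 * c)"
        "p (y k) * \<bar>D s (y(k := y k - 1)) - D s y\<bar> \<le> C * (2 * c)"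
        using rates[of "y k"] c0 by (intro mult_mono; linarith)+
      then show "\<bar>q (y k) * (D s (y(k := y k + 1)) - D s y) + p (y k) * (D s (y(k := y k - 1)) - D s y)\<bar> \<le> 4 * C * c"
        using rates[of "y k"]
        by (intro order.trans[OF abs_triangle_ineq]) (simp add: abs_mult)
    qed
    then show "\<bar>D' s y\<bar> \<le> 2 * Suc n * (4 * C) * c" by simp
  next
    fix y assume "y \<in> G"
    then show "D 0 y = 0"
      unfolding D_def by (subst pfaffian_M_0) (auto simp: G_def le_less)
  qed (use y s in auto)
  have "y \<in> Mn" using Suc.prems(2) unfolding Mn_def by blast
  then have "D t y = 0" using zero[of y t] D0[of y t] Suc.prems(1) by blast
  then show ?case by (simp add: D_def)
qed

end

section \<open>From interval products to correlation functions\<close>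

context mixed_particle_law
begin

text \<open>The flags \<open>d\<close> and \<open>e\<close> switch on the operator
  \<open>-D^+\<close> in the first and second variable; with both on, the signs cancel.\<close>

definition dK :: "real \<Rightarrow> bool \<Rightarrow> bool \<Rightarrow> int \<Rightarrow> int \<Rightarrow> real" where
  "dK t d e y z = K t y z - of_bool d * K t (y + 1) z - of_bool e * K t y (z + 1)
     + of_bool (d \<and> e) * K t (y + 1) (z + 1)"

definition N :: "real \<Rightarrow> (nat \<Rightarrow> bool) \<Rightarrow> (nat \<Rightarrow> int) \<Rightarrow> nat \<Rightarrow> nat \<Rightarrow> real" where
  "N t d y = skew (\<lambda>a b. dK t (d a) (d b) (y a) (y b))"

text \<open>By linearity in row and column \<open>k\<close>, a difference in one end point can be
  taken inside the matrix.\<close>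

lemma pfaffian_N_row:
  assumes "k < 2*n" "\<not> d k"
  shows "pfaffian n (N t (d(k := True)) y) = pfaffian n (N t d y) - pfaffian n (N t d (y(k := y k + 1)))"
  using assms by (intro pfaffian_row_diff[of k]) (auto simp: N_def skew_def dK_def)

text \<open>Indices \<open>2*i\<close> and \<open>2*i+1\<close> stand for the left and right end of
  an interval at \<open>x i\<close>. For \<open>i < m\<close> the right end has been differenced;
  for the others \<open>b\<close> chooses between the one-site and the empty interval. The induction
  expands one factor \<open>1 - spin\<close>, and \<open>pfaffian_N_row\<close> makes the same
  subtraction in the Pfaffian.\<close>

lemma E_par_differences:
  fixes x :: "nat \<Rightarrow> int"
  assumes t: "t \<ge> 0" and x: "\<And>i j. i < j \<Longrightarrow> j < n \<Longrightarrow> x i < x j"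
    and "m \<le> n" and "\<And>i. i < m \<Longrightarrow> \<not> b i"
  shows "(\<integral>\<omega>. (\<Prod>i<n. if i < m then 1 - spin \<theta> {x i} \<omega> else if b i then spin \<theta> {x i} \<omega> else 1) \<partial>(\<mu> t))
    = pfaffian n (N t (\<lambda>a. odd a \<and> a < 2*m) (\<lambda>a. x (a div 2) + of_bool (odd a \<and> b (a div 2))))"
  using assms(3,4)
proof (induction m arbitrary: b)
  case 0
  define y where "y = (\<lambda>a. x (a div 2) + of_bool (odd a \<and> b (a div 2)))"
  \<comment> \<open>One-site intervals at neighbouring sites touch and empty ones have equal ends,
    so the end points are only weakly increasing.\<close>
  have mono: "y i \<le> y j" if "i \<le> j" "j < 2*n" for i j
  proof (cases "i div 2 = j div 2")
    case True
    then have "i = j \<or> even i" using that by presburger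
    then show ?thesis using True by (auto simp: y_def)
  next
    case False
    then have "i div 2 < j div 2" "j div 2 < n" using that by (auto simp: div_le_mono le_neq_implies_less)
    then have "x (i div 2) + 1 \<le> x (j div 2)" using x by fastforce
    then show ?thesis by (auto simp: y_def)
  qed
  have "(\<Prod>i<n. if i < 0 then 1 - spin \<theta> {x i} \<omega> else if b i then spin \<theta> {x i} \<omega> else 1) = spin \<theta> (par n y) \<omega>" for \<omega>
  proof -
    have "spin \<theta> (par n y) \<omega> = (\<Prod>i<n. spin \<theta> {y (2*i)..<y (2*i+1)} \<omega>)"
      by (rule spin_par_mono) (rule mono)
    also have "\<dots> = (\<Prod>i<n. if i < 0 then 1 - spin \<theta> {x i} \<omega> else if b i then spin \<theta> {x i} \<omega> else 1)"
    proof (intro prod.cong refl)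
      fix i
      have "{x i..<x i + 1} = {x i}" by auto
      then show "spin \<theta> {y (2*i)..<y (2*i+1)} \<omega> = (if i < 0 then 1 - spin \<theta> {x i} \<omega> else if b i then spin \<theta> {x i} \<omega> else 1)"
        by (simp add: y_def)
    qed
    finally show ?thesis ..
  qed
  then have "(\<integral>\<omega>. (\<Prod>i<n. if i < 0 then 1 - spin \<theta> {x i} \<omega> else if b i then spin \<theta> {x i} \<omega> else 1) \<partial>(\<mu> t)) = E t (par n y)"
    by (simp add: E_def)
  also have "\<dots> = pfaffian n (M t y)"
    by (rule E_par_eq_pfaffian[OF t]) (rule mono)
  also have "M t y = N t (\<lambda>a. odd a \<and> a < 2*0) y"
    by (simp add: M_def N_def dK_def)
  finally show ?case unfolding y_def .
next
  case (Suc m)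
  define F where "F m b \<omega> = (\<Prod>i<n. if i < m then 1 - spin \<theta> {x i} \<omega> else if b i then spin \<theta> {x i} \<omega> else 1)" for m b \<omega>
  define y where "y b = (\<lambda>a. x (a div 2) + of_bool (odd a \<and> b (a div 2)))" for b
  have m: "m < n" using Suc.prems by simp
  have int: "integrable (\<mu> t) (F j c)" for j c
  proof -
    interpret P: prob_space "\<mu> t" by (rule prob[OF t])
    have "F j c \<in> borel_measurable config_space"
      unfolding F_def[abs_def] by (intro borel_measurable_prod) measurable
    moreover have "\<bar>F j c \<omega>\<bar> \<le> (\<Prod>i<n. 2)" for \<omega>
      unfolding F_def abs_prod
    proof (rule prod_mono)
      fix i
      show "0 \<le> \<bar>if i < j then 1 - spin \<theta> {x i} \<omega> else if c i then spin \<theta> {x i} \<omega> else 1\<bar> \<and>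
         \<bar>if i < j then 1 - spin \<theta> {x i} \<omega> else if c i then spin \<theta> {x i} \<omega> else 1\<bar> \<le> 2"
        using spin_bound[OF \<theta>0 \<theta>1, of "{x i}" \<omega>] by (auto simp: abs_le_iff)
    qed
    ultimately show ?thesis
      using measurable_\<mu>[OF t] by (intro P.integrable_const_bound[where B = "\<Prod>i<n. 2"]) auto
  qed
  \<comment> \<open>At site \<open>m\<close> the minuend has the empty interval and the subtrahend
    the one-site interval.\<close>
  have F_step: "F (Suc m) b \<omega> = F m b \<omega> - F m (b(m := True)) \<omega>" for \<omega>
  proof -
    define r where "r = (\<Prod>i\<in>{..<n}-{m}. if i < m then 1 - spin \<theta> {x i} \<omega> else if b i then spin \<theta> {x i} \<omega> else 1)"
    have split: "F j c \<omega> = (if m < j then 1 - spin \<theta> {x m} \<omega> else if c m then spin \<theta> {x m} \<omega> else 1) * r"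
      if "\<And>i. i \<noteq> m \<Longrightarrow> (i < j \<longleftrightarrow> i < m) \<and> (c i \<longleftrightarrow> b i)" for j c
    proof -
      have "(\<Prod>i\<in>{..<n}-{m}. if i < j then 1 - spin \<theta> {x i} \<omega> else if c i then spin \<theta> {x i} \<omega> else 1) = r"
        unfolding r_def using that by (intro prod.cong refl) auto
      then show ?thesis unfolding F_def using m by (subst prod.remove[of _ m]) auto
    qed
    have "F (Suc m) b \<omega> = (1 - spin \<theta> {x m} \<omega>) * r" "F m (b(m := True)) \<omega> = spin \<theta> {x m} \<omega> * r"
      "F m b \<omega> = 1 * r"
      using Suc.prems(2)[of m] by (subst split; auto)+
    then show ?thesis by (simp add: left_diff_distrib)
  qed
  have "(\<integral>\<omega>. F (Suc m) b \<omega> \<partial>(\<mu> t)) = (\<integral>\<omega>. F m b \<omega> \<partial>(\<mu> t)) - (\<integral>\<omega>. F m (b(m := True)) \<omega> \<partial>(\<mu> t))"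
    unfolding F_step using int by simp
  also have "(\<integral>\<omega>. F m b \<omega> \<partial>(\<mu> t)) = pfaffian n (N t (\<lambda>a. odd a \<and> a < 2*m) (y b))"
    unfolding F_def y_def by (rule Suc.IH) (use Suc.prems in auto)
  also have "(\<integral>\<omega>. F m (b(m := True)) \<omega> \<partial>(\<mu> t)) = pfaffian n (N t (\<lambda>a. odd a \<and> a < 2*m) (y (b(m := True))))"
    unfolding F_def y_def by (rule Suc.IH) (use Suc.prems in auto)
  \<comment> \<open>Filling the interval at \<open>x m\<close> moves its right end, which has index
    \<open>2*m+1\<close>.\<close>
  also have "y (b(m := True)) = (y b)(2*m+1 := y b (2*m+1) + 1)"
    using Suc.prems(2)[of m] by (auto simp: y_def fun_eq_iff elim!: oddE) presburger
  also have "pfaffian n (N t (\<lambda>a. odd a \<and> a < 2*m) (y b)) - pfaffian n (N t (\<lambda>a. odd a \<and> a < 2*m) \<dots>)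
     = pfaffian n (N t ((\<lambda>a. odd a \<and> a < 2*m)(2*m+1 := True)) (y b))"
    by (rule pfaffian_N_row[symmetric]) (use m in auto)
  also have "(\<lambda>a. odd a \<and> a < 2*m)(2*m+1 := True) = (\<lambda>a::nat. odd a \<and> a < 2 * Suc m)"
    by (auto simp: fun_eq_iff elim!: oddE)
  finally show ?case unfolding F_def y_def .
qed

abbreviation Kt :: "real \<Rightarrow> int \<Rightarrow> int \<Rightarrow> real" where
  "Kt t \<equiv> \<lambda>y z. \<integral>\<omega>. sigma_fn \<theta> y z \<omega> \<partial>(\<mu> t)"

text \<open>With \<open>m = n\<close> every site is differenced, and
  \<open>1 - spin \<theta> {x} \<omega>\<close> is \<open>1 + \<theta>\<close> times the occupation
  variable. The Pfaffian is homogeneous of degree \<open>n\<close>, so a factor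
  \<open>1 / (1 + \<theta>)\<close> goes into each entry. Even indices carry no difference and odd
  ones do, which yields the 2x2 blocks.\<close>

lemma correlation_sorted:
  assumes t: "t \<ge> 0" and x: "\<And>i j. i < j \<Longrightarrow> j < n \<Longrightarrow> x i < x j"
  shows "(\<integral>\<omega>. (\<Prod>i<n. of_bool (\<omega> (x i))) \<partial>(\<mu> t))
    = pfaffian n (\<lambda>a b. pf_kernel \<theta> (Kt t) (x (a div 2)) (x (b div 2)) (a mod 2) (b mod 2))"
proof -
  define y where "y = (\<lambda>a. x (a div 2))"
  have \<theta>: "1 + \<theta> > 0" using \<theta>0 by simp
  have Kt: "Kt t = K t" by (simp add: fun_eq_iff K_def E_def sigma_fn_eq_spin)
  have "(\<Prod>i<n. if i < n then 1 - spin \<theta> {x i} \<omega> else if False then spin \<theta> {x i} \<omega> else 1)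
      = (1 + \<theta>) ^ n * (\<Prod>i<n. of_bool (\<omega> (x i)))" for \<omega>
  proof -
    have "(\<Prod>i<n. if i < n then 1 - spin \<theta> {x i} \<omega> else if False then spin \<theta> {x i} \<omega> else 1)
        = (\<Prod>i<n. (1 + \<theta>) * of_bool (\<omega> (x i)))"
      by (intro prod.cong refl) (auto simp: spin_def)
    then show ?thesis by (simp add: prod.distrib)
  qed
  then have "(1 + \<theta>) ^ n * (\<integral>\<omega>. (\<Prod>i<n. of_bool (\<omega> (x i))) \<partial>(\<mu> t))
      = (\<integral>\<omega>. (\<Prod>i<n. if i < n then 1 - spin \<theta> {x i} \<omega> else if False then spin \<theta> {x i} \<omega> else 1) \<partial>(\<mu> t))"
    by simp
  also have "\<dots> = pfaffian n (N t (\<lambda>a. odd a \<and> a < 2*n) (\<lambda>a. x (a div 2) + of_bool (odd a \<and> False)))"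
    by (rule E_par_differences[OF t]) (use x in auto)
  also have "(\<lambda>a. x (a div 2) + of_bool (odd a \<and> False)) = y"
    by (simp add: y_def)
  finally have "(\<integral>\<omega>. (\<Prod>i<n. of_bool (\<omega> (x i))) \<partial>(\<mu> t))
      = (1 / (1 + \<theta>)) ^ n * pfaffian n (N t (\<lambda>a. odd a \<and> a < 2*n) y)"
    using \<theta> by (simp add: field_simps power_divide)
  also have "\<dots> = pfaffian n (\<lambda>a b. 1 / (1 + \<theta>) * N t (\<lambda>a. odd a \<and> a < 2*n) y a b)"
    by (rule pfaffian_scale[symmetric])
  also have "\<dots> = pfaffian n (\<lambda>a b. pf_kernel \<theta> (Kt t) (x (a div 2)) (x (b div 2)) (a mod 2) (b mod 2))"
    unfolding Kt
  proof (rule pfaffian_cong)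
    fix a b assume ab: "a < 2*n" "b < 2*n" "a \<noteq> b"
    have lt: "x (i div 2) < x (j div 2)" if "i div 2 < j div 2" "j < 2*n" for i j
      using x that by auto
    have mod: "a mod 2 = of_bool (odd a)" "b mod 2 = of_bool (odd b)" by (auto simp: mod_2_eq_odd)
    \<comment> \<open>On a single site only the two off-diagonal entries of the block occur; the
      upper one is \<open>K(y,y) - K(y,y+1)\<close>, divided by \<open>1 + \<theta>\<close>.\<close>
    consider "a div 2 < b div 2" | "b div 2 < a div 2" | "a div 2 = b div 2" "a < b" | "a div 2 = b div 2" "b < a"
      using ab(3) by linarith
    then show "1 / (1 + \<theta>) * N t (\<lambda>a. odd a \<and> a < 2*n) y a b
       = pf_kernel \<theta> (K t) (x (a div 2)) (x (b div 2)) (a mod 2) (b mod 2)"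
    proof cases
      case 1
      then have "a < b" by (meson div_le_mono leD leI)
      then show ?thesis
        using lt[OF 1 ab(2)] ab
        by (simp add: N_def skew_def y_def dK_def pf_kernel_def kernel_block_def mod)
    next
      case 2
      then have "b < a" by (meson div_le_mono leD leI)
      then show ?thesis
        using lt[OF 2 ab(1)] ab
        by (simp add: N_def skew_def y_def dK_def pf_kernel_def kernel_block_def mod add_divide_distrib diff_divide_distrib)
    next
      case 3
      then have "even a" "odd b" by presburger+
      then show ?thesis
        using 3 ab by (simp add: N_def skew_def y_def dK_def pf_kernel_def mod add_divide_distrib diff_divide_distrib)
    next
      case 4
      then have "even b" "odd a" by presburger+
      then show ?thesis
        using 4 ab by (simp add: N_def skew_def y_def dK_def pf_kernel_def mod add_divide_distrib diff_divide_distrib)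
    qed
  qed
  finally show ?thesis .
qed

text \<open>Both sides are invariant under reordering of the sites, the Pfaffian by
  \<open>block_permutation\<close>, so sorting the list reduces to
  \<open>correlation_sorted\<close>.\<close>

lemma correlation:
  assumes t: "t \<ge> 0" and "distinct xs"
  shows "(\<integral>\<omega>. (\<Prod>x\<leftarrow>xs. of_bool (\<omega> x)) \<partial>(\<mu> t)) =
    pfaffian (length xs) (\<lambda>a b. pf_kernel \<theta> (Kt t) (xs ! (a div 2)) (xs ! (b div 2)) (a mod 2) (b mod 2))"
proof -
  define ys where "ys = sort xs"
  define n where "n = length xs"
  have ys: "sorted_wrt (<) ys" "length ys = n" "set ys = set xs" "distinct ys"
    using assms(2) by (auto simp: ys_def n_def strict_sorted_iff)
  obtain f where f: "f permutes {..<length ys}" "permute_list f ys = xs"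
    using mset_eq_permutation[of xs ys] by (auto simp: ys_def)
  have f': "f permutes {0..<n}" using f(1) ys by (simp add: atLeast0LessThan)
  have nth: "xs ! i = ys ! f i" if "i < n" for i
    using permute_list_nth[OF f(1), of i] that f(2) ys by simp
  define \<rho> where "\<rho> m = 2 * f (m div 2) + m mod 2" for m :: nat
  have \<rho>: "\<rho> permutes {0..<2*n}" "sign \<rho> = 1"
    using block_permutation[OF f'] unfolding \<rho>_def[abs_def] by auto
  define L where "L a b = pf_kernel \<theta> (Kt t) (ys ! (a div 2)) (ys ! (b div 2)) (a mod 2) (b mod 2)" for a b
  have "(\<Prod>x\<leftarrow>xs. of_bool (\<omega> x)) = (\<Prod>i<n. of_bool (\<omega> (ys ! i)) :: real)" for \<omega> :: config
  proof -
    have "(\<Prod>x\<leftarrow>xs. of_bool (\<omega> x) :: real) = (\<Prod>x\<in>set xs. of_bool (\<omega> x))"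
      using assms(2) by (rule prod.distinct_set_conv_list[symmetric])
    also have "\<dots> = (\<Prod>x\<leftarrow>ys. of_bool (\<omega> x))"
      using prod.distinct_set_conv_list[OF ys(4), of "\<lambda>x. of_bool (\<omega> x)"] ys(3) by simp
    also have "\<dots> = (\<Prod>i<n. of_bool (\<omega> (ys ! i)))"
      using ys(2) by (simp add: prod.list_conv_set_nth atLeast0LessThan)
    finally show ?thesis .
  qed
  then have "(\<integral>\<omega>. (\<Prod>x\<leftarrow>xs. of_bool (\<omega> x)) \<partial>(\<mu> t)) = (\<integral>\<omega>. (\<Prod>i<n. of_bool (\<omega> (ys ! i)) :: real) \<partial>(\<mu> t))"
    by simp
  also have "\<dots> = pfaffian n L"
    unfolding L_def
  proof (rule correlation_sorted[OF t])
    show "ys ! i < ys ! j" if "i < j" "j < n" for i j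
      using sorted_wrt_nth_less[OF ys(1)] that ys(2) by simp
  qed
  also have "\<dots> = pfaffian n (\<lambda>a b. L (\<rho> a) (\<rho> b))"
    using pfaffian_permute[OF \<rho>(1), of L] \<rho>(2) by simp
  also have "\<dots> = pfaffian n (\<lambda>a b. pf_kernel \<theta> (Kt t) (xs ! (a div 2)) (xs ! (b div 2)) (a mod 2) (b mod 2))"
  proof (rule pfaffian_cong)
    fix a b assume "a < 2*n" "b < 2*n"
    then have "xs ! (a div 2) = ys ! f (a div 2)" "xs ! (b div 2) = ys ! f (b div 2)" by (auto intro: nth)
    then show "L (\<rho> a) (\<rho> b) = pf_kernel \<theta> (Kt t) (xs ! (a div 2)) (xs ! (b div 2)) (a mod 2) (b mod 2)"
      by (simp add: L_def \<rho>_def)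
  qed
  finally show ?thesis by (simp add: n_def)
qed

end

lemma pf_kernel_antisym:
  assumes "i < 2" "j < 2"
  shows "pf_kernel \<theta> K y z i j = - pf_kernel \<theta> K z y j i"
proof -
  have "i = 0 \<or> i = 1" "j = 0 \<or> j = 1" using assms by auto
  then show ?thesis by (auto simp: pf_kernel_def)
qed

theorem theorem1:
  fixes \<theta> :: real and p q :: "int \<Rightarrow> real" and \<eta> :: config
    and \<mu> :: "real \<Rightarrow> config measure" and t :: real
  assumes "0 \<le> \<theta>" and "\<theta> \<le> 1"
    and "\<forall>x. 0 \<le> p x \<and> 0 \<le> q x"
    and "\<exists>C. \<forall>x. p x \<le> C \<and> q x \<le> C"
    and "is_process_law \<theta> p q \<eta> \<mu>"
    and "0 \<le> t"
  shows "pfaffian_pp (\<mu> t)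
           (pf_kernel \<theta> (\<lambda>y z. \<integral>\<omega>. sigma_fn \<theta> y z \<omega> \<partial>(\<mu> t)))"
proof -
  obtain C where C: "\<And>x. p x \<le> C" "\<And>x. q x \<le> C" using assms(4) by blast
  interpret mixed_particle_law \<theta> p q \<eta> \<mu> C
    using assms C by unfold_locales auto
  show ?thesis
    unfolding pfaffian_pp_def using correlation[OF assms(6)] pf_kernel_antisym by blast
qed

end
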